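(* Let $(M,\nabla,g)$ be a compact Hessian manifold, let $\rho$ be a positive $(-1)$-density on $M$, and let $u$ and $v$ be two $g$-convex functions on $M$ such that $$e^{-u}M_{\rho,g}[u]\geq e^{-v}M_{\rho,g}[v]$$ in the sense of measures. Then $u\leq v$ on $M$.
   Context: An affine manifold $(M,\nabla)$ is a manifold with a flat torsion-free connection $\nabla$; equivalently it has an atlas of affine charts whose transition maps are (locally) affine maps $x\mapsto Ax+b$ of $\mathbb{R}^n$. A Hessian metric on $(M,\nabla)$ is a Riemannian metric $g$ which is locally of the form $g=\nabla d\phi$ with $\phi$ a smooth (strictly convex) function, i.e. $g_{ij}=\partial^2\phi/\partial x^i\partial x^j$ in affine coordinates; $(M,\nabla,g)$ is then a Hessian manifold, and $\phi$ is called a local potential of $g$. A function $u:M\to\mathbb{R}$ is $g$-convex if it is continuous and, on every affine chart domain $U$ with convex image in $\mathbb{R}^n$ on which $g=\nabla d\phi$, the function $\phi+u$ is convex in the affine coordinates. $\mathcal{K}(M,g)$ is the set of all $g$-convex functions. A $(-1)$-density $\rho$ is given in each affine chart $x_\alpha$ by a function $\rho_\alpha$, with $\rho_\beta=\left|\det\frac{\partial x_\alpha}{\partial x_\beta}\right|^{-1}\rho_\alpha$ on overlaps; positive means that all $\rho_\alpha$ are continuous and $>0$. For $u\in\mathcal{K}(M,g)$ of class $C^2$, $M_{\rho,g}[u]$ is the globally well-defined measure on $M$ given in affine coordinates by $\rho\,\det(g_{ij}+u_{ij})\,dx^1\cdots dx^n$, where $u_{ij}=\partial^2u/\partial x^i\partial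 x^j$. For arbitrary $u\in\mathcal{K}(M,g)$, $M_{\rho,g}[u]$ is the weak limit of the measures $M_{\rho,g}[u_j]$, where $u_j\in\mathcal{K}(M,g)$ is any sequence of smooth functions converging uniformly to $u$ (such sequences exist, and the limit exists and does not depend on the sequence). *)

theory Defs
  imports "HOL-Analysis.Analysis"
begin

section \<open>Smooth functions on open subsets of Euclidean space\<close>

definition partial_deriv :: "'n::finite \<Rightarrow> (real^'n \<Rightarrow> real) \<Rightarrow> real^'n \<Rightarrow> real" where
  "partial_deriv i f z = frechet_derivative f (at z) (axis i 1)"

text \<open>Only meant for open \<open>S\<close>, because the derivatives are full derivatives at points of \<open>S\<close>.\<close>

primrec Ck_on :: "nat \<Rightarrow> (real^'n::finite) set \<Rightarrow> (real^'n \<Rightarrow> real) \<Rightarrow> bool" where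
  "Ck_on 0 S f \<longleftrightarrow> continuous_on S f"
| "Ck_on (Suc k) S f \<longleftrightarrow>
     (\<forall>z\<in>S. f differentiable (at z)) \<and> (\<forall>i. Ck_on k S (partial_deriv i f))"

definition smooth_on :: "(real^'n::finite) set \<Rightarrow> (real^'n \<Rightarrow> real) \<Rightarrow> bool" where
  "smooth_on S f \<longleftrightarrow> (\<forall>k. Ck_on k S f)"

definition hessian :: "(real^'n::finite \<Rightarrow> real) \<Rightarrow> real^'n \<Rightarrow> real^'n^'n" where
  "hessian f z = (\<chi> i j. partial_deriv i (partial_deriv j f) z)"


section \<open>Affine manifolds\<close>

text \<open>
  The manifold is the whole type \<open>'a\<close>, of dimension \<open>CARD('n)\<close>. A chart is a pair of its domain and
  its coordinate map; the values of the coordinate map outside the domain are irrelevant.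
\<close>

type_synonym ('a, 'n) chart = "'a set \<times> ('a \<Rightarrow> real^'n)"

definition is_chart :: "('a::topological_space, 'n::finite) chart \<Rightarrow> bool" where
  "is_chart = (\<lambda>(U, x). open U \<and> open (x ` U) \<and> (\<exists>y. homeomorphism U (x ` U) x y))"

definition affinely_compatible ::
    "('a::topological_space, 'n::finite) chart \<Rightarrow> ('a, 'n) chart \<Rightarrow> bool" where
  "affinely_compatible = (\<lambda>(U, x) (V, y).
     \<forall>p \<in> U \<inter> V. \<exists>W A b. open W \<and> p \<in> W \<and> W \<subseteq> U \<inter> V \<and> invertible A \<and>
       (\<forall>q\<in>W. y q = A *v x q + b))"

text \<open>
  A flat torsion-free connection is given by its maximal atlas of affine charts, so that the members
  of \<open>\<A>\<close> are all the affine charts of the manifold.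
\<close>

definition affine_manifold ::
    "('a::{t2_space, second_countable_topology}, 'n::finite) chart set \<Rightarrow> bool" where
  "affine_manifold \<A> \<longleftrightarrow>
     (\<Union>(U, x)\<in>\<A>. U) = UNIV \<and>
     (\<forall>c\<in>\<A>. is_chart c) \<and>
     (\<forall>c\<in>\<A>. \<forall>d\<in>\<A>. affinely_compatible c d) \<and>
     (\<forall>c. is_chart c \<and> (\<forall>d\<in>\<A>. affinely_compatible c d) \<longrightarrow> c \<in> \<A>)"

definition coord_expr :: "('a, 'n::finite) chart \<Rightarrow> ('a \<Rightarrow> 'b) \<Rightarrow> real^'n \<Rightarrow> 'b" where
  "coord_expr = (\<lambda>(U, x) f z. f (inv_into U x z))"

text \<open>\<open>coord_jacobian c d p\<close> is the matrix of partial derivatives of the coordinates of \<open>c\<close> with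
  respect to those of \<open>d\<close>, at \<open>p\<close>.\<close>

definition coord_jacobian ::
    "('a, 'n::finite) chart \<Rightarrow> ('a, 'n) chart \<Rightarrow> 'a \<Rightarrow> real^'n^'n" where
  "coord_jacobian c d p = jacobian (coord_expr d (snd c)) (at (snd d p))"

definition smooth_function ::
    "('a, 'n::finite) chart set \<Rightarrow> ('a \<Rightarrow> real) \<Rightarrow> bool" where
  "smooth_function \<A> f \<longleftrightarrow> (\<forall>(U, x)\<in>\<A>. smooth_on (x ` U) (coord_expr (U, x) f))"


section \<open>Hessian metrics, convex functions, densities\<close>

text \<open>
  Tensor fields and densities are families of local expressions, indexed by the affine charts;
  \<open>g c p\<close> is the matrix at \<open>p\<close> of the coefficients of the metric in the coordinates of \<open>c\<close>.
\<close>

definition riemannian_metric ::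
    "('a, 'n::finite) chart set \<Rightarrow> (('a, 'n) chart \<Rightarrow> 'a \<Rightarrow> real^'n^'n) \<Rightarrow> bool" where
  "riemannian_metric \<A> g \<longleftrightarrow>
     (\<forall>c\<in>\<A>. \<forall>p\<in>fst c. transpose (g c p) = g c p \<and> (\<forall>\<xi>. \<xi> \<noteq> 0 \<longrightarrow> \<xi> \<bullet> (g c p *v \<xi>) > 0)) \<and>
     (\<forall>c\<in>\<A>. \<forall>i j. smooth_on (snd c ` fst c) (coord_expr c (\<lambda>p. g c p $ i $ j))) \<and>
     (\<forall>c\<in>\<A>. \<forall>d\<in>\<A>. \<forall>p \<in> fst c \<inter> fst d.
        g d p = transpose (coord_jacobian c d p) ** g c p ** coord_jacobian c d p)"

text \<open>\<open>\<phi>\<close> is a potential of \<open>g\<close> on the open subset \<open>W\<close> of the domain of the affine chart \<open>c\<close>.\<close>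

definition is_potential ::
    "(('a, 'n::finite) chart \<Rightarrow> 'a \<Rightarrow> real^'n^'n) \<Rightarrow> ('a, 'n) chart \<Rightarrow> 'a set \<Rightarrow> ('a \<Rightarrow> real) \<Rightarrow> bool"
  where
  "is_potential g c W \<phi> \<longleftrightarrow>
     smooth_on (snd c ` W) (coord_expr c \<phi>) \<and>
     (\<forall>p\<in>W. g c p = hessian (coord_expr c \<phi>) (snd c p))"

text \<open>Strict convexity of the potentials is a consequence of the positive definiteness of \<open>g\<close>.\<close>

definition hessian_metric ::
    "('a::topological_space, 'n::finite) chart set \<Rightarrow> (('a, 'n) chart \<Rightarrow> 'a \<Rightarrow> real^'n^'n) \<Rightarrow> bool"
  where
  "hessian_metric \<A> g \<longleftrightarrow>
     riemannian_metric \<A> g \<and>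
     (\<forall>c\<in>\<A>. \<forall>p\<in>fst c. \<exists>W \<phi>. open W \<and> p \<in> W \<and> W \<subseteq> fst c \<and> is_potential g c W \<phi>)"

definition hessian_manifold ::
    "('a::{t2_space, second_countable_topology}, 'n::finite) chart set \<Rightarrow>
     (('a, 'n) chart \<Rightarrow> 'a \<Rightarrow> real^'n^'n) \<Rightarrow> bool" where
  "hessian_manifold \<A> g \<longleftrightarrow> affine_manifold \<A> \<and> hessian_metric \<A> g"

definition g_convex ::
    "('a::topological_space, 'n::finite) chart set \<Rightarrow> (('a, 'n) chart \<Rightarrow> 'a \<Rightarrow> real^'n^'n) \<Rightarrow>
     ('a \<Rightarrow> real) \<Rightarrow> bool" where
  "g_convex \<A> g u \<longleftrightarrow>
     continuous_on UNIV u \<and>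
     (\<forall>(U, x)\<in>\<A>. \<forall>\<phi>. convex (x ` U) \<and> is_potential g (U, x) U \<phi> \<longrightarrow>
        convex_on (x ` U) (coord_expr (U, x) (\<lambda>p. \<phi> p + u p)))"

definition positive_neg1_density ::
    "('a::topological_space, 'n::finite) chart set \<Rightarrow> (('a, 'n) chart \<Rightarrow> 'a \<Rightarrow> real) \<Rightarrow> bool" where
  "positive_neg1_density \<A> \<rho> \<longleftrightarrow>
     (\<forall>c\<in>\<A>. continuous_on (fst c) (\<rho> c) \<and> (\<forall>p\<in>fst c. \<rho> c p > 0)) \<and>
     (\<forall>c\<in>\<A>. \<forall>d\<in>\<A>. \<forall>p \<in> fst c \<inter> fst d. \<rho> d p = inverse \<bar>det (coord_jacobian c d p)\<bar> * \<rho> c p)"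


section \<open>Monge--Ampere measures\<close>

text \<open>
  For \<open>u\<close> of class \<open>C\<^sup>2\<close>: \<open>\<mu>\<close> is the Borel measure with density \<open>\<rho> det (g\<^sub>i\<^sub>j + u\<^sub>i\<^sub>j)\<close> in affine
  coordinates. As countably many chart domains cover the manifold, there is at most one such \<open>\<mu>\<close>.
\<close>

definition is_MA_measure_C2 ::
    "('a::topological_space, 'n::finite) chart set \<Rightarrow> (('a, 'n) chart \<Rightarrow> 'a \<Rightarrow> real^'n^'n) \<Rightarrow>
     (('a, 'n) chart \<Rightarrow> 'a \<Rightarrow> real) \<Rightarrow> ('a \<Rightarrow> real) \<Rightarrow> 'a measure \<Rightarrow> bool" where
  "is_MA_measure_C2 \<A> g \<rho> u \<mu> \<longleftrightarrow>
     sets \<mu> = sets borel \<and>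
     (\<forall>c\<in>\<A>. \<forall>A\<in>sets borel. A \<subseteq> fst c \<longrightarrow>
        emeasure \<mu> A =
          (\<integral>\<^sup>+z\<in>snd c ` A. ennreal (coord_expr c (\<rho> c) z *
             det (coord_expr c (g c) z + hessian (coord_expr c u) z)) \<partial>lborel))"

text \<open>Weak convergence of finite Borel measures on a compact space, where every continuous function
  is bounded.\<close>

definition converges_weakly ::
    "(nat \<Rightarrow> 'a::topological_space measure) \<Rightarrow> 'a measure \<Rightarrow> bool" where
  "converges_weakly M N \<longleftrightarrow>
     (\<forall>k. sets (M k) = sets borel \<and> finite_measure (M k)) \<and>
     sets N = sets borel \<and> finite_measure N \<and>
     (\<forall>f::'a \<Rightarrow> real. continuous_on UNIV f \<longrightarrow>
        (\<lambda>k. integral\<^sup>L (M k) f) \<longlonglongrightarrow> integral\<^sup>L N f)"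

text \<open>
  \<open>\<mu>\<close> is the Monge--Ampere measure of the \<open>g\<close>-convex function \<open>u\<close>: the weak limit along some sequence
  of smooth \<open>g\<close>-convex functions converging uniformly to \<open>u\<close>. On a compact Hessian manifold, such
  sequences exist, and the limit exists for each of them and is always the same, so that the choice
  of the sequence is immaterial and exactly one \<open>\<mu>\<close> satisfies the predicate.
\<close>

definition is_MA_measure ::
    "('a::topological_space, 'n::finite) chart set \<Rightarrow> (('a, 'n) chart \<Rightarrow> 'a \<Rightarrow> real^'n^'n) \<Rightarrow>
     (('a, 'n) chart \<Rightarrow> 'a \<Rightarrow> real) \<Rightarrow> ('a \<Rightarrow> real) \<Rightarrow> 'a measure \<Rightarrow> bool" where
  "is_MA_measure \<A> g \<rho> u \<mu> \<longleftrightarrow>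
     (\<exists>(w :: nat \<Rightarrow> 'a \<Rightarrow> real) M.
        (\<forall>k. smooth_function \<A> (w k) \<and> g_convex \<A> g (w k) \<and> is_MA_measure_C2 \<A> g \<rho> (w k) (M k)) \<and>
        uniform_limit UNIV w u sequentially \<and>
        converges_weakly M \<mu>)"

end

theory Submission
  imports Defs
begin

text \<open>
  Suppose \<open>u > v\<close> somewhere and let \<open>p\<^sub>0\<close> maximise \<open>u - (1 + \<epsilon>) v\<close> over the compact manifold, with \<open>\<epsilon>\<close>
  small enough that still \<open>u - v > m > 0\<close> near \<open>p\<^sub>0\<close>. In an affine chart with potential \<open>\<phi>\<close> put
  \<open>U = \<phi> + u\<close>, \<open>V = \<phi> + v\<close>. Then \<open>U - (1 + \<epsilon>) V + \<epsilon> \<phi>\<close> is maximal at \<open>p\<^sub>0\<close>, and since \<open>\<phi>\<close> is strictly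
  convex, subtracting \<open>\<epsilon>\<close> times its tangent at \<open>p\<^sub>0\<close> shows that \<open>U - W\<close>, where \<open>W\<close> is \<open>(1 + \<epsilon>) V\<close> plus an
  affine function, has a strict maximum at \<open>p\<^sub>0\<close>. No perturbation by a quadratic function is needed, so
  the Monge--Ampere measure of \<open>W\<close> is just \<open>(1 + \<epsilon>)\<^sup>n\<close> times that of \<open>V\<close>.

  For smooth functions, every slope of \<open>U\<close> on a small superlevel set \<open>O\<close> of \<open>U - W\<close> is a slope of \<open>W\<close> on \<open>O\<close>, so the
  area formula gives \<open>\<integral>\<^sub>O det D\<^sup>2U \<le> \<integral>\<^sub>O det D\<^sup>2W\<close>. Integrating over the levels yields an inequality
  between the integrals of the continuous function \<open>(U - W + s)\<^sup>+\<close>, which survives the weak limits. There the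
  measure of \<open>u\<close> is at most \<open>(1 + \<epsilon>)\<^sup>n\<^sup>+\<^sup>1\<close> times that of \<open>v\<close>, one factor \<open>1 + \<epsilon>\<close> being the
  oscillation of \<open>\<rho>\<close>, whereas by hypothesis it is at least \<open>e\<^sup>m\<close> times that of \<open>v\<close>. Both sides
  are positive, because the slopes of \<open>W\<close> on \<open>O\<close> fill a ball whose radius is bounded below.
\<close>

section \<open>The area formula over arbitrary finite index types\<close>

text \<open>The change of variables theorems of the library require the index type to be well-ordered; \<open>'a index\<close>
  is a well-ordered copy of \<open>'a\<close> along which they are transported.\<close>

typedef 'a index = "{..<CARD('a::finite)}"
  by (metis lessThan_iff zero_less_card_finite)

instantiation index :: (finite) wellorder
begin

definition less_eq_index :: "'a index \<Rightarrow> 'a index \<Rightarrow> bool" where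
  "less_eq_index i j \<longleftrightarrow> Rep_index i \<le> Rep_index j"

definition less_index :: "'a index \<Rightarrow> 'a index \<Rightarrow> bool" where
  "less_index i j \<longleftrightarrow> Rep_index i < Rep_index j"

instance
proof
  fix P :: "'a index \<Rightarrow> bool" and i
  assume step: "\<And>x. (\<And>y. y < x \<Longrightarrow> P y) \<Longrightarrow> P x"
  show "P i"
    by (induction i rule: measure_induct_rule[where f = Rep_index])
       (rule step, simp add: less_index_def)
qed (auto simp: less_eq_index_def less_index_def Rep_index_inject)

end

instance index :: (finite) finite
proof
  have "(UNIV :: 'a index set) = Abs_index ` {..<CARD('a)}"
    by (rule type_definition.univ[OF type_definition_index])
  then show "finite (UNIV :: 'a index set)"
    by (metis finite_imageI finite_lessThan)
qed

lemma card_index: "CARD('a::finite index) = CARD('a)"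
  using type_definition.card[OF type_definition_index] by simp

lemma obtain_index_bij: obtains \<tau> :: "'a::finite \<Rightarrow> 'a index" where "bij \<tau>"
proof -
  have "\<exists>\<tau>. bij_betw \<tau> (UNIV :: 'a set) (UNIV :: 'a index set)"
    by (rule finite_same_card_bij) (simp_all add: card_index)
  then show thesis
    using that by blast
qed

text \<open>Conjugation by \<tau> is a sign-preserving bijection between the permutations of the two
  index types, so the Leibniz sums agree term by term.\<close>

lemma det_reindex:
  fixes A :: "'b::comm_ring_1^'m^'m" and \<tau> :: "'n::finite \<Rightarrow> 'm::finite"
  assumes "bij \<tau>"
  shows "det (\<chi> i j. A $ \<tau> i $ \<tau> j) = det A"
proof -
  let ?c = "map_permutation UNIV \<tau>"
  have inj: "inj \<tau>" and surj: "surj \<tau>"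
    using assms by (auto simp: bij_def)
  have c: "?c p = \<tau> \<circ> p \<circ> inv \<tau>" for p
    unfolding map_permutation_def using surj by (simp add: fun_eq_iff restrict_id_def)
  have bij: "bij_betw ?c {p. p permutes UNIV} {p. p permutes UNIV}"
  proof (rule bij_betw_byWitness[where f' = "\<lambda>q. inv \<tau> \<circ> q \<circ> \<tau>"])
    show "\<forall>p\<in>{p. p permutes UNIV}. inv \<tau> \<circ> ?c p \<circ> \<tau> = p"
      using inj by (auto simp: c fun_eq_iff)
    show "\<forall>q\<in>{p. p permutes UNIV}. ?c (inv \<tau> \<circ> q \<circ> \<tau>) = q"
      using surj by (auto simp: c fun_eq_iff surj_f_inv_f)
    show "?c ` {p. p permutes UNIV} \<subseteq> {p. p permutes UNIV}"
      using map_permutation_permutes[OF assms] by auto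
    have "inv \<tau> \<circ> q \<circ> \<tau> permutes UNIV" if "q permutes UNIV" for q
    proof -
      have "bij (inv \<tau> \<circ> q \<circ> \<tau>)"
        using assms that by (simp add: bij_comp bij_imp_bij_inv permutes_bij)
      then show ?thesis
        by (auto intro: bij_imp_permutes)
    qed
    then show "(\<lambda>q. inv \<tau> \<circ> q \<circ> \<tau>) ` {p. p permutes UNIV} \<subseteq> {p. p permutes UNIV}"
      by auto
  qed
  have "det A = (\<Sum>p | p permutes UNIV. of_int (sign (?c p)) * (\<Prod>i\<in>UNIV. A $ i $ ?c p i))"
    unfolding det_def by (rule sum.reindex_bij_betw[OF bij, symmetric])
  also have "\<dots> = (\<Sum>p | p permutes UNIV. of_int (sign p) * (\<Prod>i\<in>UNIV. A $ \<tau> i $ \<tau> (p i)))"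
  proof (rule sum.cong[OF refl])
    fix p :: "'n \<Rightarrow> 'n" assume p: "p \<in> {p. p permutes UNIV}"
    have "(\<Prod>i\<in>UNIV. A $ i $ ?c p i) = (\<Prod>i\<in>UNIV. A $ \<tau> i $ ?c p (\<tau> i))"
      by (rule prod.reindex_bij_betw[OF assms, symmetric])
    also have "\<dots> = (\<Prod>i\<in>UNIV. A $ \<tau> i $ \<tau> (p i))"
      using inj by (simp add: c)
    finally show "of_int (sign (?c p)) * (\<Prod>i\<in>UNIV. A $ i $ ?c p i) =
        of_int (sign p) * (\<Prod>i\<in>UNIV. A $ \<tau> i $ \<tau> (p i))"
      using p inj by (simp add: sign_map_permutation)
  qed
  finally show ?thesis
    by (simp add: det_def)
qed

text \<open>Injectivity makes the left integral equal to the measure of \<open>f\<close>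
  S\<open>, whereas the right integral only dominates the measure of\<close>h \<open>T\<close>,
  whose points may be hit repeatedly. The inclusion of the images links the two.\<close>

lemma area_comparison_wellorder:
  fixes f h :: "real^'n::{finite,wellorder} \<Rightarrow> real^'n::_" and A B :: "real^'n::_ \<Rightarrow> real^'n::_^'n::_"
  assumes S: "S \<in> sets borel" and T: "T \<in> sets borel"
    and f: "\<And>x. x \<in> S \<Longrightarrow> (f has_derivative (*v) (A x)) (at x)"
    and h: "\<And>x. x \<in> T \<Longrightarrow> (h has_derivative (*v) (B x)) (at x)"
    and inj: "inj_on f S" and sub: "f ` S \<subseteq> h ` T"
    and mA: "set_borel_measurable borel S (\<lambda>x. \<bar>det (A x)\<bar>)"
    and mB: "set_borel_measurable borel T (\<lambda>x. \<bar>det (B x)\<bar>)"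
    and fin: "(\<integral>\<^sup>+x\<in>S. ennreal \<bar>det (A x)\<bar> \<partial>lborel) < \<infinity>"
  shows "(\<integral>\<^sup>+x\<in>S. ennreal \<bar>det (A x)\<bar> \<partial>lborel) \<le> (\<integral>\<^sup>+x\<in>T. ennreal \<bar>det (B x)\<bar> \<partial>lborel)"
proof (cases "(\<integral>\<^sup>+x\<in>T. ennreal \<bar>det (B x)\<bar> \<partial>lborel) < \<infinity>")
  case True
  \<comment> \<open>Finiteness turns the nonnegative integral into a gauge integral, the form in
    which the change of variables is stated. An infinite right-hand side is trivial.\<close>
  have on: "(\<lambda>x. \<bar>det (C x)\<bar>) integrable_on X"
    if "set_borel_measurable borel X (\<lambda>x. \<bar>det (C x)\<bar>)"
      "(\<integral>\<^sup>+x\<in>X. ennreal \<bar>det (C x)\<bar> \<partial>lborel) < \<infinity>" for C :: "real^'n::_ \<Rightarrow> real^'n::_^'n::_" and X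
  proof -
    have "(\<integral>\<^sup>+x. ennreal (indicator X x * \<bar>det (C x)\<bar>) \<partial>lborel) = (\<integral>\<^sup>+x\<in>X. ennreal \<bar>det (C x)\<bar> \<partial>lborel)"
      by (intro nn_integral_cong) (auto simp: indicator_def)
    then have "(\<lambda>x. indicator X x * \<bar>det (C x)\<bar>) integrable_on UNIV"
      using that by (intro nn_integral_integrable_on) (auto simp: set_borel_measurable_def)
    then have "(\<lambda>x. if x \<in> X then \<bar>det (C x)\<bar> else 0) integrable_on UNIV"
      by (rule integrable_eq) (auto simp: indicator_def)
    then show ?thesis
      by (simp only: integrable_restrict_UNIV)
  qed
  have f': "(f has_derivative (*v) (A x)) (at x within S)" if "x \<in> S" for x
    using f[OF that] has_derivative_at_withinI by blast
  have h': "(h has_derivative (*v) (B x)) (at x within T)" if "x \<in> T" for x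
    using h[OF that] has_derivative_at_withinI by blast
  have iA: "(\<lambda>x. \<bar>det (matrix ((*v) (A x)))\<bar>) integrable_on S"
    using on[OF mA fin] by simp
  have iB: "(\<lambda>x. \<bar>det (matrix ((*v) (B x)))\<bar>) integrable_on T"
    using on[OF mB True] by simp
  have S': "S \<in> sets lebesgue" and T': "T \<in> sets lebesgue"
    using S T by auto
  have "integral S (\<lambda>x. \<bar>det (matrix ((*v) (A x)))\<bar>) = measure lebesgue (f ` S)"
    by (rule measure_differentiable_image_eq[OF S' f' inj iA, symmetric])
  also have "\<dots> \<le> measure lebesgue (h ` T)"
    by (rule measure_mono_fmeasurable[OF sub _ measurable_differentiable_image[OF T' h' iB]])
       (use measurable_differentiable_image[OF S' f' iA] in auto)
  also have "\<dots> \<le> integral T (\<lambda>x. \<bar>det (matrix ((*v) (B x)))\<bar>)"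
    by (rule measure_differentiable_image[OF T' h' iB])
  finally have "integral S (\<lambda>x. \<bar>det (A x)\<bar>) \<le> integral T (\<lambda>x. \<bar>det (B x)\<bar>)"
    by simp
  then show ?thesis
    using set_nn_integral_lborel_eq_integral[OF mA _ fin] set_nn_integral_lborel_eq_integral[OF mB _ True]
    by (simp add: ennreal_leI)
qed (auto simp: not_less top_unique)

definition reindex :: "('m \<Rightarrow> 'n) \<Rightarrow> real^'n::finite \<Rightarrow> real^'m::finite" where
  "reindex \<sigma> x = (\<chi> i. x $ \<sigma> i)"

lemma linear_reindex: "linear (reindex \<sigma>)"
  by (rule linearI) (simp_all add: reindex_def vec_eq_iff)

lemma continuous_reindex [continuous_intros]: "continuous_on X (reindex \<sigma>)"
  by (simp add: linear_continuous_on linear_conv_bounded_linear[symmetric] linear_reindex)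

lemma borel_measurable_reindex [measurable]: "reindex \<sigma> \<in> borel_measurable borel"
  by (intro borel_measurable_continuous_onI continuous_reindex)

lemma reindex_inverse:
  assumes "bij \<sigma>"
  shows "reindex \<sigma> (reindex (inv \<sigma>) x) = x" "reindex (inv \<sigma>) (reindex \<sigma> y) = y"
  using assms by (simp_all add: reindex_def vec_eq_iff bij_is_inj bij_is_surj surj_f_inv_f)

text \<open>Lebesgue measure is determined by its values on boxes, and a permutation of the
  coordinates only permutes the side lengths of a box.\<close>

lemma lborel_reindex:
  fixes \<sigma> :: "'m::finite \<Rightarrow> 'n::finite"
  assumes "bij \<sigma>"
  shows "lborel = distr lborel borel (reindex \<sigma>)"
proof (rule lborel_eqI)
  fix l u :: "real^'m" assume lu: "\<And>b. b \<in> Basis \<Longrightarrow> l \<bullet> b \<le> u \<bullet> b"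
  then have le: "l $ i \<le> u $ i" for i
    by (metis axis_in_Basis_iff cart_eq_inner_axis insertI1 Basis_real_def)
  have prod_Basis: "(\<Prod>b\<in>Basis. x \<bullet> b) = (\<Prod>i\<in>UNIV. x $ i)" for x :: "real^'k::finite"
  proof -
    have "(\<Prod>b\<in>Basis. x \<bullet> b) = (\<Prod>b\<in>range (\<lambda>i. axis i (1::real)). x \<bullet> b)"
      by (rule prod.cong) (auto simp: Basis_vec_def)
    also have "\<dots> = (\<Prod>i\<in>UNIV. x $ i)"
      by (subst prod.reindex) (auto simp: inj_on_def axis_eq_axis cart_eq_inner_axis)
    finally show ?thesis .
  qed
  have "reindex \<sigma> -` box l u = box (reindex (inv \<sigma>) l) (reindex (inv \<sigma>) u)"
  proof (rule set_eqI)
    fix x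
    have "(\<forall>i. l $ i < x $ \<sigma> i \<and> x $ \<sigma> i < u $ i) \<longleftrightarrow>
        (\<forall>j. l $ inv \<sigma> j < x $ j \<and> x $ j < u $ inv \<sigma> j)"
      using assms by (metis bij_inv_eq_iff)
    then show "x \<in> reindex \<sigma> -` box l u \<longleftrightarrow> x \<in> box (reindex (inv \<sigma>) l) (reindex (inv \<sigma>) u)"
      by (simp add: mem_box_cart reindex_def)
  qed
  then have "emeasure (distr lborel borel (reindex \<sigma>)) (box l u) =
      emeasure lborel (box (reindex (inv \<sigma>) l) (reindex (inv \<sigma>) u))"
    by (subst emeasure_distr) auto
  also have "\<dots> = (\<Prod>b\<in>Basis. (reindex (inv \<sigma>) u - reindex (inv \<sigma>) l) \<bullet> b)"
    by (rule emeasure_lborel_box)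
       (use le in \<open>auto simp: Basis_vec_def inner_axis reindex_def\<close>)
  also have "(\<Prod>b\<in>Basis. (reindex (inv \<sigma>) u - reindex (inv \<sigma>) l) \<bullet> b) =
      (\<Prod>j\<in>UNIV. (u - l) $ inv \<sigma> j)"
    by (simp add: prod_Basis reindex_def)
  also have "\<dots> = (\<Prod>i\<in>UNIV. (u - l) $ i)"
    by (rule prod.reindex_bij_betw[OF bij_imp_bij_inv[OF assms]])
  also have "\<dots> = (\<Prod>b\<in>Basis. (u - l) \<bullet> b)"
    by (simp add: prod_Basis)
  finally show "emeasure (distr lborel borel (reindex \<sigma>)) (box l u) = (\<Prod>b\<in>Basis. (u - l) \<bullet> b)" .
qed simp

lemma reindex_matrix_vector_mult:
  fixes A :: "real^'n^'n" and \<sigma> :: "'m::finite \<Rightarrow> 'n::finite"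
  assumes "bij \<sigma>"
  shows "reindex \<sigma> (A *v reindex (inv \<sigma>) x) = (\<chi> i j. A $ \<sigma> i $ \<sigma> j) *v x"
proof -
  have "(\<Sum>j\<in>UNIV. A $ \<sigma> i $ j * x $ inv \<sigma> j) = (\<Sum>j\<in>UNIV. A $ \<sigma> i $ \<sigma> j * x $ j)" for i
    using sum.reindex_bij_betw[OF assms, of "\<lambda>j. A $ \<sigma> i $ j * x $ inv \<sigma> j"] assms
    by (simp add: bij_is_inj)
  then show ?thesis
    by (simp add: reindex_def vec_eq_iff matrix_vector_mult_def)
qed

text \<open>Both maps are conjugated by a permutation of the coordinates. This reindexes the rows
  and columns of the derivatives without changing determinants (\<open>det_reindex\<close>), and it
  preserves Lebesgue measure (\<open>lborel_reindex\<close>).\<close>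

theorem area_comparison:
  fixes f h :: "real^'n::finite \<Rightarrow> real^'n" and A B :: "real^'n \<Rightarrow> real^'n^'n"
  assumes S: "S \<in> sets borel" and T: "T \<in> sets borel"
    and f: "\<And>x. x \<in> S \<Longrightarrow> (f has_derivative (*v) (A x)) (at x)"
    and h: "\<And>x. x \<in> T \<Longrightarrow> (h has_derivative (*v) (B x)) (at x)"
    and inj: "inj_on f S" and sub: "f ` S \<subseteq> h ` T"
    and mA: "set_borel_measurable borel S (\<lambda>x. \<bar>det (A x)\<bar>)"
    and mB: "set_borel_measurable borel T (\<lambda>x. \<bar>det (B x)\<bar>)"
    and fin: "(\<integral>\<^sup>+x\<in>S. ennreal \<bar>det (A x)\<bar> \<partial>lborel) < \<infinity>"
  shows "(\<integral>\<^sup>+x\<in>S. ennreal \<bar>det (A x)\<bar> \<partial>lborel) \<le> (\<integral>\<^sup>+x\<in>T. ennreal \<bar>det (B x)\<bar> \<partial>lborel)"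
proof -
  obtain \<tau> :: "'n \<Rightarrow> 'n index" where \<tau>: "bij \<tau>"
    by (rule obtain_index_bij)
  define \<sigma> where "\<sigma> = inv \<tau>"
  have \<sigma>: "bij \<sigma>"
    using \<tau> by (simp add: \<sigma>_def bij_imp_bij_inv)
  let ?R = "reindex \<sigma> :: real^'n \<Rightarrow> real^'n index" and ?Q = "reindex (inv \<sigma>) :: real^'n index \<Rightarrow> real^'n"
  have RQ [simp]: "?R (?Q y) = y" and QR [simp]: "?Q (?R x) = x" for x y
    using reindex_inverse[OF \<sigma>] by auto
  define C where "C M y = (\<chi> i j. M (?Q y) $ \<sigma> i $ \<sigma> j)" for M :: "real^'n \<Rightarrow> real^'n^'n" and y
  have det_C: "det (C M y) = det (M (?Q y))" for M y
    unfolding C_def by (rule det_reindex[OF \<sigma>])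
  have img: "?R ` X = ?Q -` X" for X
    by (auto simp: image_iff) (metis RQ)
  have deriv: "((\<lambda>y. ?R (k (?Q y))) has_derivative (*v) (C M y)) (at y)"
    if "y \<in> ?Q -` X" "\<And>x. x \<in> X \<Longrightarrow> (k has_derivative (*v) (M x)) (at x)" for k M X y
  proof -
    have lin: "(reindex \<kappa> has_derivative reindex \<kappa>) F" for \<kappa> :: "'a::finite \<Rightarrow> 'b::finite" and F
      by (rule linear_imp_has_derivative[OF linear_reindex])
    have "(?R \<circ> (k \<circ> ?Q) has_derivative ?R \<circ> ((*v) (M (?Q y)) \<circ> ?Q)) (at y)"
      by (intro diff_chain_at lin that(2)) (use that(1) in auto)
    then show ?thesis
      unfolding C_def by (simp add: o_def reindex_matrix_vector_mult[OF \<sigma>])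
  qed
  have bor: "?Q -` X \<in> sets borel" if "X \<in> sets borel" for X
    using measurable_sets[OF borel_measurable_reindex that] by simp
  have meas: "set_borel_measurable borel (?Q -` X) (\<lambda>y. \<bar>det (C M y)\<bar>)"
    if "set_borel_measurable borel X (\<lambda>x. \<bar>det (M x)\<bar>)" for X and M
    using measurable_compose[OF borel_measurable_reindex that[unfolded set_borel_measurable_def]]
    unfolding set_borel_measurable_def det_C by (simp add: indicator_def)
  have int: "(\<integral>\<^sup>+y\<in>?Q -` X. ennreal \<bar>det (C M y)\<bar> \<partial>lborel) = (\<integral>\<^sup>+x\<in>X. ennreal \<bar>det (M x)\<bar> \<partial>lborel)"
    if "set_borel_measurable borel X (\<lambda>x. \<bar>det (M x)\<bar>)" for X and M
  proof -
    have [measurable]: "(\<lambda>x. indicator X x * \<bar>det (M x)\<bar>) \<in> borel_measurable borel"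
      using that by (simp add: set_borel_measurable_def)
    have "(\<integral>\<^sup>+x\<in>X. ennreal \<bar>det (M x)\<bar> \<partial>lborel) = (\<integral>\<^sup>+x. ennreal (indicator X x * \<bar>det (M x)\<bar>) \<partial>lborel)"
      by (intro nn_integral_cong) (auto simp: indicator_def)
    also have "\<dots> = (\<integral>\<^sup>+x. ennreal (indicator X x * \<bar>det (M x)\<bar>) \<partial>distr lborel borel ?Q)"
      by (subst lborel_reindex[OF bij_imp_bij_inv[OF \<sigma>]]) simp
    also have "\<dots> = (\<integral>\<^sup>+y. ennreal (indicator X (?Q y) * \<bar>det (M (?Q y))\<bar>) \<partial>lborel)"
      by (subst nn_integral_distr) auto
    also have "\<dots> = (\<integral>\<^sup>+y\<in>?Q -` X. ennreal \<bar>det (C M y)\<bar> \<partial>lborel)"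
      unfolding det_C by (intro nn_integral_cong) (auto simp: indicator_def)
    finally show ?thesis ..
  qed
  have "(\<integral>\<^sup>+y\<in>?Q -` S. ennreal \<bar>det (C A y)\<bar> \<partial>lborel) \<le> (\<integral>\<^sup>+y\<in>?Q -` T. ennreal \<bar>det (C B y)\<bar> \<partial>lborel)"
  proof (rule area_comparison_wellorder[where f = "\<lambda>y. ?R (f (?Q y))" and h = "\<lambda>y. ?R (h (?Q y))"])
    show "inj_on (\<lambda>y. ?R (f (?Q y))) (?Q -` S)"
      using inj by (intro inj_onI) (metis QR RQ inj_onD vimage_eq)
    show "(\<lambda>y. ?R (f (?Q y))) ` (?Q -` S) \<subseteq> (\<lambda>y. ?R (h (?Q y))) ` (?Q -` T)"
    proof -
      have "(\<lambda>y. ?R (k (?Q y))) ` (?Q -` X) = ?R ` k ` X" for k X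
        unfolding img[symmetric] image_image by simp
      then show ?thesis
        using sub by (simp add: image_mono)
    qed
    show "(\<integral>\<^sup>+y\<in>?Q -` S. ennreal \<bar>det (C A y)\<bar> \<partial>lborel) < \<infinity>"
      using int[OF mA] fin by simp
  qed (use deriv f h bor S T meas mA mB in blast)+
  then show ?thesis
    by (simp add: int[OF mA] int[OF mB])
qed

section \<open>Comparison of Hessian determinants\<close>

definition grad :: "(real^'n::finite \<Rightarrow> real) \<Rightarrow> real^'n \<Rightarrow> real^'n" where
  "grad f z = (\<chi> i. partial_deriv i f z)"

text \<open>Gradient and Hessian are carried along explicitly, so that those of sums, multiples and
  affine terms are given by formulas instead of being recovered from Frechet derivatives each
  time.\<close>

definition C2_data ::
  "(real^'n::finite) set \<Rightarrow> (real^'n \<Rightarrow> real) \<Rightarrow> (real^'n \<Rightarrow> real^'n) \<Rightarrow> (real^'n \<Rightarrow> real^'n^'n) \<Rightarrow> bool" where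
  "C2_data B F G H \<longleftrightarrow>
     (\<forall>z\<in>B. (F has_derivative (\<lambda>h. G z \<bullet> h)) (at z) \<and> (G has_derivative (*v) (H z)) (at z)) \<and>
     continuous_on B H"

lemma C2_data_subset: "C2_data B F G H \<Longrightarrow> C \<subseteq> B \<Longrightarrow> C2_data C F G H"
  by (auto simp: C2_data_def intro: continuous_on_subset)

lemma C2_data_add:
  "C2_data B F G H \<Longrightarrow> C2_data B F' G' H' \<Longrightarrow>
   C2_data B (\<lambda>z. F z + F' z) (\<lambda>z. G z + G' z) (\<lambda>z. H z + H' z)"
  unfolding C2_data_def
  by (auto simp: inner_add_left matrix_vector_mult_add_rdistrib intro!: derivative_eq_intros continuous_intros)

lemma C2_data_cmult:
  assumes "C2_data B F G H"
  shows "C2_data B (\<lambda>z. c * F z) (\<lambda>z. c *\<^sub>R G z) (\<lambda>z. c *\<^sub>R H z)"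
proof -
  have "(\<lambda>h. c *\<^sub>R (H z *v h)) = (*v) (c *\<^sub>R H z)" for z
    by (auto simp: scaleR_matrix_vector_assoc)
  moreover have "((\<lambda>z. c *\<^sub>R G z) has_derivative (\<lambda>h. c *\<^sub>R (H z *v h))) (at z)" if "z \<in> B" for z
    using assms that by (intro has_derivative_scaleR_right) (auto simp: C2_data_def)
  ultimately show ?thesis
    using assms unfolding C2_data_def
    by (auto intro!: derivative_eq_intros continuous_intros)
qed

lemma C2_data_affine: "C2_data B (\<lambda>z. a + b \<bullet> z) (\<lambda>_. b) (\<lambda>_. 0)"
  unfolding C2_data_def by (auto intro!: derivative_eq_intros)

text \<open>Entry (i, j) of \<open>hessian f\<close> is the i-th derivative of the j-th partial
  derivative, whereas the derivative matrix of the gradient has the j-th derivative of the i-th one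
  there; hence the transpose, which changes neither determinants nor quadratic forms.\<close>

lemma smooth_on_C2_data:
  assumes "smooth_on S f"
  shows "C2_data S f (grad f) (\<lambda>z. transpose (hessian f z))"
proof -
  have "Ck_on 2 S f"
    using assms by (simp add: smooth_on_def)
  then have f: "\<And>z. z \<in> S \<Longrightarrow> f differentiable (at z)"
    and df: "\<And>z i. z \<in> S \<Longrightarrow> partial_deriv i f differentiable (at z)"
    and ddf: "\<And>i j. continuous_on S (partial_deriv i (partial_deriv j f))"
    by (simp_all add: numeral_2_eq_2)
  have fd: "(k has_derivative (\<lambda>h. grad k z \<bullet> h)) (at z)" if k: "k differentiable (at z)" for k z
  proof -
    have k': "(k has_derivative frechet_derivative k (at z)) (at z)"
      using k by (simp add: frechet_derivative_works)
    have "frechet_derivative k (at z) h = grad k z \<bullet> h" for h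
    proof -
      have lin: "linear (frechet_derivative k (at z))"
        using k' has_derivative_linear by blast
      have "frechet_derivative k (at z) h = frechet_derivative k (at z) (\<Sum>i\<in>UNIV. h $ i *\<^sub>R axis i 1)"
        by (simp add: basis_expansion flip: scalar_mult_eq_scaleR)
      also have "\<dots> = grad k z \<bullet> h"
        by (simp add: linear_sum[OF lin] linear_scale[OF lin] grad_def partial_deriv_def inner_vec_def
            mult.commute)
      finally show ?thesis .
    qed
    then have "frechet_derivative k (at z) = (\<lambda>h. grad k z \<bullet> h)"
      by auto
    then show ?thesis
      using k' by simp
  qed
  have "(grad f has_derivative (*v) (transpose (hessian f z))) (at z)" if z: "z \<in> S" for z
  proof -
    have "((\<lambda>z. \<chi> i. partial_deriv i f z) has_derivative (\<lambda>h. \<chi> i. grad (partial_deriv i f) z \<bullet> h)) (at z)"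
      by (subst has_derivative_componentwise_within)
      (use fd df[OF z] in \<open>auto simp: Basis_vec_def inner_axis\<close>)
    moreover have "(\<chi> i. grad (partial_deriv i f) z \<bullet> h) = transpose (hessian f z) *v h" for h
      by (simp add: vec_eq_iff grad_def hessian_def transpose_def matrix_vector_mult_def inner_vec_def)
    ultimately have "((\<lambda>z. \<chi> i. partial_deriv i f z) has_derivative (*v) (transpose (hessian f z))) (at z)"
      by (simp only:)
    then show ?thesis
      by (simp only: grad_def[abs_def])
  qed
  moreover have "continuous_on S (\<lambda>z. transpose (hessian f z))"
    unfolding transpose_def hessian_def by (intro continuous_on_vec_lambda) (simp add: ddf)
  ultimately show ?thesis
    using f fd by (auto simp: C2_data_def)
qed

lemma has_vector_derivative_along_line:
  assumes "(F has_derivative F') (at (x + t *\<^sub>R d))"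
  shows "((\<lambda>s. F (x + s *\<^sub>R d)) has_vector_derivative F' d) (at t)"
proof -
  have "((\<lambda>s. x + s *\<^sub>R d) has_derivative (\<lambda>s. s *\<^sub>R d)) (at t)"
    by (auto intro!: derivative_eq_intros)
  then have "((\<lambda>s. F (x + s *\<^sub>R d)) has_derivative (\<lambda>s. F' (s *\<^sub>R d))) (at t)"
    using assms diff_chain_at by (fastforce simp: o_def)
  then show ?thesis
    unfolding has_vector_derivative_def
    using has_derivative_linear[OF assms] by (simp add: linear_scale)
qed

lemma C2_data_along_line:
  assumes "C2_data B F G H" "x + t *\<^sub>R d \<in> B"
  shows "((\<lambda>s. F (x + s *\<^sub>R d)) has_real_derivative G (x + t *\<^sub>R d) \<bullet> d) (at t)"
    and "((\<lambda>s. G (x + s *\<^sub>R d)) has_vector_derivative H (x + t *\<^sub>R d) *v d) (at t)"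
    and "((\<lambda>s. G (x + s *\<^sub>R d) \<bullet> d) has_real_derivative (H (x + t *\<^sub>R d) *v d) \<bullet> d) (at t)"
proof -
  show "((\<lambda>s. F (x + s *\<^sub>R d)) has_real_derivative G (x + t *\<^sub>R d) \<bullet> d) (at t)"
    unfolding has_real_derivative_iff_has_vector_derivative
    by (rule has_vector_derivative_along_line) (use assms in \<open>auto simp: C2_data_def\<close>)
  show v: "((\<lambda>s. G (x + s *\<^sub>R d)) has_vector_derivative H (x + t *\<^sub>R d) *v d) (at t)"
    by (rule has_vector_derivative_along_line) (use assms in \<open>auto simp: C2_data_def\<close>)
  show "((\<lambda>s. G (x + s *\<^sub>R d) \<bullet> d) has_real_derivative (H (x + t *\<^sub>R d) *v d) \<bullet> d) (at t)"
    unfolding has_real_derivative_iff_has_vector_derivative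
    by (rule bounded_linear.has_vector_derivative[OF bounded_linear_inner_left v])
qed

section \<open>Tangents and Hessians of convex functions\<close>

lemma deriv_nonneg_at_right:
  fixes f :: "real \<Rightarrow> real"
  assumes "(f has_real_derivative D) (at 0)" "eventually (\<lambda>t. f 0 \<le> f t) (at_right 0)"
  shows "0 \<le> D"
proof -
  have "((\<lambda>t. (f t - f 0) / t) \<longlongrightarrow> D) (at_right 0)"
    using assms(1) by (auto simp: has_field_derivative_iff filterlim_at_split)
  moreover have "eventually (\<lambda>t. 0 \<le> (f t - f 0) / t) (at_right 0)"
    using assms(2) eventually_at_right_less[of "0::real"] by eventually_elim simp
  ultimately show ?thesis
    by (rule tendsto_lowerbound) simp
qed

text \<open>The chord minus the function along the segment, \<open>?f\<close>, vanishes at 0 and is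
  nonnegative on (0, 1). Its derivative at 0 is exactly the gap between \<open>F y\<close> and the
  tangent.\<close>

lemma convex_above_tangent:
  assumes "C2_data B F G H" "convex_on B F" "x \<in> B" "y \<in> B"
  shows "F x + G x \<bullet> (y - x) \<le> F y"
proof -
  let ?f = "\<lambda>t. (1 - t) * F x + t * F y - F (x + t *\<^sub>R (y - x))"
  have "(?f has_real_derivative (F y - F x - G x \<bullet> (y - x))) (at 0)"
    using C2_data_along_line(1)[OF assms(1), of x 0 "y - x"] assms(3)
    by (auto intro!: derivative_eq_intros)
  moreover have "eventually (\<lambda>t. ?f 0 \<le> ?f t) (at_right 0)"
  proof -
    have "?f 0 \<le> ?f t" if "0 < t" "t < 1" for t
    proof -
      have "F ((1 - t) *\<^sub>R x + t *\<^sub>R y) \<le> (1 - t) * F x + t * F y"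
        using convex_onD[OF assms(2), of t x y] that assms by simp
      moreover have "(1 - t) *\<^sub>R x + t *\<^sub>R y = x + t *\<^sub>R (y - x)"
        by (simp add: algebra_simps)
      ultimately show ?thesis
        by simp
    qed
    moreover have "eventually (\<lambda>t. 0 < t \<and> t < (1::real)) (at_right 0)"
      by (auto simp: eventually_at_right_field intro: exI[of _ 1])
    ultimately show ?thesis
      by (auto elim: eventually_mono)
  qed
  ultimately have "0 \<le> F y - F x - G x \<bullet> (y - x)"
    by (rule deriv_nonneg_at_right)
  then show ?thesis
    by simp
qed

lemma eventually_line_in_open:
  fixes x :: "'a::real_normed_vector"
  assumes "open B" "x \<in> B"
  shows "eventually (\<lambda>t. x + t *\<^sub>R d \<in> B) (at_right 0)"
proof -
  have "((\<lambda>t. x + t *\<^sub>R d) \<longlongrightarrow> x + 0 *\<^sub>R d) (at_right 0)"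
    by (intro tendsto_intros)
  then show ?thesis
    using assms topological_tendstoD by fastforce
qed

text \<open>Adding the tangent inequalities at two points of a line shows that the slope along the
  line is monotone; the quadratic form of the Hessian is the derivative of that slope.\<close>

lemma convex_hessian_nonneg:
  assumes "open B" "C2_data B F G H" "convex_on B F" "x \<in> B"
  shows "0 \<le> \<xi> \<bullet> (H x *v \<xi>)"
proof -
  have "((\<lambda>s. G (x + s *\<^sub>R \<xi>) \<bullet> \<xi>) has_real_derivative (H x *v \<xi>) \<bullet> \<xi>) (at 0)"
    using C2_data_along_line(3)[OF assms(2), of x 0 \<xi>] assms(4) by simp
  moreover have "eventually (\<lambda>t. G (x + 0 *\<^sub>R \<xi>) \<bullet> \<xi> \<le> G (x + t *\<^sub>R \<xi>) \<bullet> \<xi>) (at_right 0)"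
    using eventually_line_in_open[OF assms(1,4), of \<xi>] eventually_at_right_less[of "0::real"]
  proof eventually_elim
    case (elim t)
    have "F x + G x \<bullet> (t *\<^sub>R \<xi>) \<le> F (x + t *\<^sub>R \<xi>)"
      using convex_above_tangent[OF assms(2,3,4) elim(1)] by simp
    moreover have "F (x + t *\<^sub>R \<xi>) + G (x + t *\<^sub>R \<xi>) \<bullet> (- t *\<^sub>R \<xi>) \<le> F x"
      using convex_above_tangent[OF assms(2,3) elim(1) assms(4)] by simp
    ultimately have "t * (G x \<bullet> \<xi>) \<le> t * (G (x + t *\<^sub>R \<xi>) \<bullet> \<xi>)"
      by simp
    then show ?case
      using elim(2) by simp
  qed
  ultimately have "0 \<le> (H x *v \<xi>) \<bullet> \<xi>"
    by (rule deriv_nonneg_at_right)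
  then show ?thesis
    by (simp add: inner_commute)
qed

section \<open>Determinants and nonnegative quadratic forms\<close>

lemma continuous_on_det:
  fixes A :: "'a::topological_space \<Rightarrow> real^'n::finite^'n"
  shows "continuous_on S A \<Longrightarrow> continuous_on S (\<lambda>x. det (A x))"
  unfolding det_def by (intro continuous_intros)

lemma det_eq_0_iff_kernel:
  fixes A :: "real^'n::finite^'n"
  shows "det A = 0 \<longleftrightarrow> (\<exists>x. x \<noteq> 0 \<and> A *v x = 0)"
proof -
  have "det A = 0 \<longleftrightarrow> \<not> invertible A"
    by (simp add: invertible_det_nz)
  also have "\<dots> \<longleftrightarrow> \<not> (\<forall>x. A *v x = 0 \<longrightarrow> x = 0)"
    by (simp only: invertible_left_inverse matrix_left_invertible_ker)
  finally show ?thesis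
    by blast
qed

text \<open>On the segment from the identity to \<open>A\<close>, the determinant does not vanish before \<open>A\<close>.\<close>

lemma det_nonneg:
  fixes A :: "real^'n::finite^'n"
  assumes "\<And>\<xi>. 0 \<le> \<xi> \<bullet> (A *v \<xi>)"
  shows "0 \<le> det A"
proof (rule ccontr)
  assume neg: "\<not> 0 \<le> det A"
  define d where "d t = det ((1 - t) *\<^sub>R mat 1 + t *\<^sub>R A)" for t
  have "continuous_on {0..1} d"
    unfolding d_def by (intro continuous_on_det continuous_intros)
  moreover have "d 0 = 1" "d 1 < 0"
    using neg by (simp_all add: d_def)
  ultimately obtain t where t: "0 \<le> t" "t \<le> 1" "d t = 0"
    using IVT2'[of d 1 0 0] by auto
  have "t < 1"
    using t \<open>d 1 < 0\<close> by (cases "t = 1") auto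
  obtain x where x: "x \<noteq> 0" "((1 - t) *\<^sub>R mat 1 + t *\<^sub>R A) *v x = 0"
    using t(3) unfolding d_def det_eq_0_iff_kernel by blast
  \<comment> \<open>For t < 1 the identity contributes a positive multiple of
    \<open>x \<bullet> x\<close>, so no nonzero \<open>x\<close> lies in the kernel.\<close>
  have "0 = x \<bullet> (((1 - t) *\<^sub>R mat 1 + t *\<^sub>R A) *v x)"
    by (simp add: x(2))
  also have "\<dots> = (1 - t) * (x \<bullet> x) + t * (x \<bullet> (A *v x))"
    by (simp add: matrix_vector_mult_add_rdistrib inner_add_right scaleR_matrix_vector_assoc[symmetric])
  also have "\<dots> > 0"
    using t(1) \<open>t < 1\<close> x(1) assms[of x] by (intro add_pos_nonneg) auto
  finally show False
    by simp
qed

section \<open>Gradient images and comparison of determinants\<close>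

lemma gradient_at_local_min:
  assumes "C2_data B F G H" "open S" "S \<subseteq> B" "x \<in> S" "\<And>y. y \<in> S \<Longrightarrow> F x - q \<bullet> x \<le> F y - q \<bullet> y"
  shows "G x = q"
proof -
  have "((\<lambda>z. F z - q \<bullet> z) has_derivative (\<lambda>h. G x \<bullet> h - q \<bullet> h)) (at x)"
    using assms(1,3,4) by (auto simp: C2_data_def intro!: derivative_eq_intros)
  then have "(\<lambda>h. G x \<bullet> h - q \<bullet> h) = (\<lambda>h. 0)"
    using differential_zero_maxmin[of x S "\<lambda>z. F z - q \<bullet> z"] assms by blast
  then have "(G x - q) \<bullet> (G x - q) = 0"
    by (metis inner_diff_left)
  then show ?thesis
    by simp
qed

text \<open>With equal gradients the tangent inequalities at \<open>x\<close> and \<open>y\<close>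
  become equalities, so every point of the segment minimises \<open>F w - G x \<bullet> w\<close>
  and has gradient \<open>G x\<close>. The direction of the segment then lies in the kernel of
  \<open>H x\<close>. Consequently the gradient is injective where the determinant does not
  vanish.\<close>

lemma det_hessian_eq_0_if_equal_gradients:
  assumes B: "open B" "convex B" and F: "C2_data B F G H" "convex_on B F"
    and xy: "x \<in> B" "y \<in> B" "x \<noteq> y" "G x = G y"
  shows "det (H x) = 0"
proof -
  let ?d = "y - x"
  have seg: "x + t *\<^sub>R ?d \<in> B \<and> G (x + t *\<^sub>R ?d) = G x" if t: "0 \<le> t" "t \<le> 1" for t
  proof
    have eq: "x + t *\<^sub>R ?d = (1 - t) *\<^sub>R x + t *\<^sub>R y"
      by (simp add: algebra_simps)
    show mem: "x + t *\<^sub>R ?d \<in> B"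
      unfolding eq using B(2) xy t by (intro convexD) auto
    have "F ((1 - t) *\<^sub>R x + t *\<^sub>R y) \<le> (1 - t) * F x + t * F y"
      using convex_onD[OF F(2), of t x y] t xy by simp
    moreover have "F x + G x \<bullet> (y - x) = F y"
      using convex_above_tangent[OF F xy(1,2)] convex_above_tangent[OF F xy(2,1)] xy(4)
      by (simp add: inner_diff_right)
    then have "t * F y = t * (F x + G x \<bullet> ?d)"
      by simp
    ultimately have le: "F (x + t *\<^sub>R ?d) \<le> F x + t * (G x \<bullet> ?d)"
      unfolding eq by (simp add: algebra_simps)
    show "G (x + t *\<^sub>R ?d) = G x"
    proof (rule gradient_at_local_min[OF F(1) B(1) subset_refl mem])
      fix w assume "w \<in> B"
      then show "F (x + t *\<^sub>R ?d) - G x \<bullet> (x + t *\<^sub>R ?d) \<le> F w - G x \<bullet> w"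
        using convex_above_tangent[OF F xy(1), of w] le by (simp add: algebra_simps inner_simps)
    qed
  qed
  \<comment> \<open>The gradient is known to be constant only for parameters in [0, 1], so
    derivatives within that interval are compared.\<close>
  have "((\<lambda>s. G (x + s *\<^sub>R ?d)) has_vector_derivative H x *v ?d) (at 0 within {0..1})"
    using C2_data_along_line(2)[OF F(1), of x 0 ?d] xy(1) has_vector_derivative_at_within by fastforce
  moreover have "((\<lambda>s. G (x + s *\<^sub>R ?d)) has_vector_derivative 0) (at 0 within {0..1})"
    by (rule has_vector_derivative_transform[where f = "\<lambda>_. G x"]) (use seg in auto)
  ultimately have "H x *v ?d = 0"
    by (rule vector_derivative_unique_within[rotated])
       (simp add: at_within_Icc_at_right)
  then show ?thesis
    using xy(3) unfolding det_eq_0_iff_kernel by (intro exI[of _ ?d]) auto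
qed

text \<open>The minimum over \<open>K\<close> of \<open>W - q \<bullet> z\<close> lies in the region where \<open>U - W > t\<close>, because outside it
  \<open>W - q \<bullet> z\<close> dominates the tangent of \<open>U\<close> at \<open>x\<close>.\<close>

lemma slope_in_gradient_image:
  assumes B: "open B" and U: "C2_data B U GU HU" "convex_on B U" and W: "C2_data B W GW HW"
    and O: "S = {z \<in> B. t < U z - W z}" "open S" and K: "compact K" "K \<subseteq> B" "S \<subseteq> K"
    and x: "x \<in> S" and q: "\<And>y. y \<in> K \<Longrightarrow> (q - GU x) \<bullet> (y - x) < U x - W x - t"
  shows "q \<in> GW ` S"
proof -
  have cont: "continuous_on K (\<lambda>z. W z - q \<bullet> z)"
  proof -
    have "W differentiable (at z)" if "z \<in> K" for z
      using W K(2) that unfolding C2_data_def differentiable_def by blast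
    then have "continuous_on K W"
      by (meson continuous_at_imp_continuous_on differentiable_imp_continuous_within)
    then show ?thesis
      by (intro continuous_intros)
  qed
  obtain y where y: "y \<in> K" and min: "\<And>z. z \<in> K \<Longrightarrow> W y - q \<bullet> y \<le> W z - q \<bullet> z"
    using continuous_attains_inf[OF K(1) _ cont] x K(3) by blast
  have "y \<in> S"
  proof (rule ccontr)
    assume "y \<notin> S"
    then have "U y - t \<le> W y"
      using y K(2) O(1) by auto
    moreover have "U x + GU x \<bullet> (y - x) \<le> U y"
      by (rule convex_above_tangent[OF U]) (use x y K O(1) in auto)
    moreover have "W y - q \<bullet> y \<le> W x - q \<bullet> x"
      using min x K(3) by blast
    ultimately show False
      using q[OF y] by (simp add: inner_diff_left inner_diff_right)
  qed
  moreover have "GW y = q"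
    by (rule gradient_at_local_min[OF W O(2) _ \<open>y \<in> S\<close>]) (use K min in auto)
  ultimately show ?thesis
    by blast
qed

lemma open_superlevel_set:
  assumes "open B" "C2_data B U GU HU" "C2_data B W GW HW"
  shows "open {z \<in> B. t < U z - W z}"
proof -
  have "continuous_on B F" if "C2_data B F G H" for F G H
    using that unfolding C2_data_def
    by (meson continuous_at_imp_continuous_on differentiableI differentiable_imp_continuous_within)
  then have "continuous_on B (\<lambda>z. U z - W z)"
    using assms by (intro continuous_intros) auto
  moreover have "{z \<in> B. t < U z - W z} = (\<lambda>z. U z - W z) -` {t<..} \<inter> B"
    by auto
  ultimately show ?thesis
    using assms(1) by (simp add: continuous_on_open_vimage)
qed

lemma set_borel_measurable_det:
  fixes H :: "real^'n::finite \<Rightarrow> real^'n^'n"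
  assumes "continuous_on B H" "S \<subseteq> B" "S \<in> sets borel"
  shows "set_borel_measurable borel S (\<lambda>x. \<bar>det (H x)\<bar>)"
  unfolding set_borel_measurable_def
  by (intro borel_measurable_continuous_on_indicator assms(3) continuous_intros continuous_on_det
      continuous_on_subset[OF assms(1,2)])

text \<open>Slopes of \<open>U\<close> on the superlevel set are slopes of \<open>W\<close> there,
  so the area formula compares the integrals. The compact \<open>K\<close> inside \<open>B\<close>
  keeps the superlevel set away from the boundary of \<open>B\<close>.\<close>

theorem hessian_det_comparison:
  fixes U W :: "real^'n::finite \<Rightarrow> real"
  assumes B: "open B" "convex B"
    and U: "C2_data B U GU HU" "convex_on B U" and W: "C2_data B W GW HW" "convex_on B W"
    and K: "compact K" "K \<subseteq> B" "{z \<in> B. t < U z - W z} \<subseteq> K"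
  shows "(\<integral>\<^sup>+z\<in>{z \<in> B. t < U z - W z}. ennreal (det (HU z)) \<partial>lborel) \<le>
    (\<integral>\<^sup>+z\<in>{z \<in> B. t < U z - W z}. ennreal (det (HW z)) \<partial>lborel)"
proof -
  let ?O = "{z \<in> B. t < U z - W z}"
  \<comment> \<open>The discarded points have no positive determinant and contribute nothing to the
    integral of \<open>U\<close>; on \<open>S\<close> the gradient of \<open>U\<close> is
    injective.\<close>
  define S where "S = {z \<in> ?O. 0 < det (HU z)}"
  have contU: "continuous_on B HU" and contW: "continuous_on B HW"
    using U(1) W(1) by (auto simp: C2_data_def)
  have openO: "open ?O"
    by (rule open_superlevel_set[OF B(1) U(1) W(1)])
  have "S = (\<lambda>z. det (HU z)) -` {0<..} \<inter> ?O"
    by (auto simp: S_def)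
  moreover have "continuous_on ?O (\<lambda>z. det (HU z))"
    by (intro continuous_on_det continuous_on_subset[OF contU]) auto
  ultimately have openS: "open S"
    using openO by (simp add: continuous_on_open_vimage)
  have nonneg: "0 \<le> det (HW z)" if "z \<in> ?O" for z
    by (rule det_nonneg, rule convex_hessian_nonneg[OF B(1) W]) (use that in auto)
  have fin: "(\<integral>\<^sup>+z\<in>S. ennreal \<bar>det (HU z)\<bar> \<partial>lborel) < \<infinity>"
  proof -
    have "compact ((\<lambda>z. det (HU z)) ` K)"
      by (intro compact_continuous_image continuous_on_det continuous_on_subset[OF contU] K)
    then have "bounded ((\<lambda>z. det (HU z)) ` K)"
      by (rule compact_imp_bounded)
    then obtain C where C: "\<And>z. z \<in> K \<Longrightarrow> \<bar>det (HU z)\<bar> \<le> C"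
      by (auto simp: bounded_real)
    have "z \<in> K \<and> \<bar>det (HU z)\<bar> \<le> C" if "z \<in> S" for z
      using that C K(3) unfolding S_def by blast
    then have "(\<integral>\<^sup>+z\<in>S. ennreal \<bar>det (HU z)\<bar> \<partial>lborel) \<le> (\<integral>\<^sup>+z. ennreal C * indicator K z \<partial>lborel)"
      by (intro nn_integral_mono) (auto simp: indicator_def intro!: ennreal_leI)
    also have "\<dots> = ennreal C * emeasure lborel K"
      using K(1) by (subst nn_integral_cmult_indicator) (auto simp: borel_compact)
    also have "\<dots> < \<infinity>"
      using emeasure_compact_finite[OF K(1)] by (simp add: ennreal_mult_less_top)
    finally show ?thesis .
  qed
  have "(\<integral>\<^sup>+z\<in>?O. ennreal (det (HU z)) \<partial>lborel) = (\<integral>\<^sup>+z\<in>S. ennreal \<bar>det (HU z)\<bar> \<partial>lborel)"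
    by (intro nn_integral_cong) (auto simp: indicator_def S_def ennreal_neg)
  also have "\<dots> \<le> (\<integral>\<^sup>+z\<in>?O. ennreal \<bar>det (HW z)\<bar> \<partial>lborel)"
  proof (rule area_comparison)
    show "(GU has_derivative (*v) (HU z)) (at z)" if "z \<in> S" for z
      using U(1) that by (auto simp: S_def C2_data_def)
    show "(GW has_derivative (*v) (HW z)) (at z)" if "z \<in> ?O" for z
      using W(1) that by (auto simp: C2_data_def)
    show "inj_on GU S"
    proof (rule inj_onI, rule ccontr)
      fix y z assume "y \<in> S" "z \<in> S" "GU y = GU z" "y \<noteq> z"
      then have "det (HU y) = 0"
        by (intro det_hessian_eq_0_if_equal_gradients[OF B U, of y z]) (auto simp: S_def)
      then show False
        using \<open>y \<in> S\<close> by (simp add: S_def)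
    qed
    \<comment> \<open>For \<open>q = GU z\<close> the left side of the slope condition is 0, and the
      condition just says that \<open>z\<close> lies in the superlevel set.\<close>
    have "GU z \<in> GW ` ?O" if "z \<in> S" for z
      by (rule slope_in_gradient_image[OF B(1) U W(1) refl openO K])
         (use that in \<open>auto simp: S_def\<close>)
    then show "GU ` S \<subseteq> GW ` ?O"
      by blast
    show "set_borel_measurable borel S (\<lambda>z. \<bar>det (HU z)\<bar>)"
      by (rule set_borel_measurable_det[OF contU]) (use openS in \<open>auto simp: S_def\<close>)
    show "set_borel_measurable borel ?O (\<lambda>z. \<bar>det (HW z)\<bar>)"
      by (rule set_borel_measurable_det[OF contW]) (use openO in auto)
  qed (use fin openO openS in auto)
  also have "\<dots> = (\<integral>\<^sup>+z\<in>?O. ennreal (det (HW z)) \<partial>lborel)"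
    using nonneg by (intro nn_integral_cong) (auto simp: indicator_def)
  finally show ?thesis .
qed

text \<open>If \<open>q\<close> is closer than \<delta> / r to \<open>GU x\<close>, then over
  \<open>K\<close> the tilt \<open>(q - GU x) \<bullet> (y - x)\<close> stays below the excess
  \<delta> of \<open>U - W\<close> over \<open>t\<close> at \<open>x\<close>. So the slopes of
  \<open>W\<close> on the superlevel set fill this ball, and the area formula is applied with the
  identity on the ball as the first map.\<close>

lemma hessian_det_lower_bound:
  fixes U W :: "real^'n::finite \<Rightarrow> real"
  assumes B: "open B" "convex B"
    and U: "C2_data B U GU HU" "convex_on B U" and W: "C2_data B W GW HW" "convex_on B W"
    and K: "compact K" "K \<subseteq> B" "{z \<in> B. t < U z - W z} \<subseteq> K"
    and x: "x \<in> B" "t + \<delta> \<le> U x - W x" and r: "0 < r" "K \<subseteq> cball x r" and "0 < \<delta>"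
  shows "emeasure lborel (ball (GU x) (\<delta> / r)) \<le>
    (\<integral>\<^sup>+z\<in>{z \<in> B. t < U z - W z}. ennreal (det (HW z)) \<partial>lborel)"
proof -
  let ?O = "{z \<in> B. t < U z - W z}" and ?S = "ball (GU x) (\<delta> / r)"
  have contW: "continuous_on B HW"
    using W(1) by (auto simp: C2_data_def)
  have openO: "open ?O"
    by (rule open_superlevel_set[OF B(1) U(1) W(1)])
  have nonneg: "0 \<le> det (HW z)" if "z \<in> ?O" for z
    by (rule det_nonneg, rule convex_hessian_nonneg[OF B(1) W]) (use that in auto)
  have emS: "(\<integral>\<^sup>+z\<in>?S. ennreal \<bar>det (mat 1 :: real^'n^'n)\<bar> \<partial>lborel) = emeasure lborel ?S"
    by simp
  have "(\<integral>\<^sup>+z\<in>?S. ennreal \<bar>det (mat 1 :: real^'n^'n)\<bar> \<partial>lborel) \<le>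
      (\<integral>\<^sup>+z\<in>?O. ennreal \<bar>det (HW z)\<bar> \<partial>lborel)"
  proof (rule area_comparison[where f = "\<lambda>z. z"])
    show "((\<lambda>z. z) has_derivative (*v) (mat 1)) (at z)" for z :: "real^'n"
      by (auto intro!: derivative_eq_intros simp: id_def[symmetric])
    show "(GW has_derivative (*v) (HW z)) (at z)" if "z \<in> ?O" for z
      using W(1) that by (auto simp: C2_data_def)
    have "q \<in> GW ` ?O" if "q \<in> ?S" for q
    proof (rule slope_in_gradient_image[OF B(1) U W(1) refl openO K])
      show "x \<in> ?O"
        using x \<open>0 < \<delta>\<close> by auto
      fix y assume "y \<in> K"
      then have "norm (y - x) \<le> r"
        using r(2) by (auto simp: dist_norm norm_minus_commute)
      then have "(q - GU x) \<bullet> (y - x) \<le> norm (q - GU x) * r"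
        using norm_cauchy_schwarz[of "q - GU x" "y - x"]
        by (meson mult_left_mono norm_ge_zero order_trans)
      also have "\<dots> < \<delta>"
        using that r(1) by (simp add: dist_norm norm_minus_commute pos_less_divide_eq)
      finally show "(q - GU x) \<bullet> (y - x) < U x - W x - t"
        using x(2) by simp
    qed
    then show "(\<lambda>z. z) ` ?S \<subseteq> GW ` ?O"
      by auto
    show "set_borel_measurable borel ?S (\<lambda>z. \<bar>det (mat 1 :: real^'n^'n)\<bar>)"
      by (rule set_borel_measurable_det[of UNIV]) auto
    show "set_borel_measurable borel ?O (\<lambda>z. \<bar>det (HW z)\<bar>)"
      by (rule set_borel_measurable_det[OF contW]) (use openO in auto)
    show "(\<integral>\<^sup>+z\<in>?S. ennreal \<bar>det (mat 1 :: real^'n^'n)\<bar> \<partial>lborel) < \<infinity>"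
      unfolding emS by (rule emeasure_lborel_ball_finite)
  qed (use openO in auto)
  also have "\<dots> = (\<integral>\<^sup>+z\<in>?O. ennreal (det (HW z)) \<partial>lborel)"
    using nonneg by (intro nn_integral_cong) (auto simp: indicator_def)
  finally show ?thesis
    unfolding emS .
qed

section \<open>Affine charts\<close>

text \<open>Coordinate expressions in a chart and in its restriction agree only on the smaller
  image, so derivatives must be seen to depend on local values alone. Both functions have the same
  derivatives at \<open>z\<close>, so the choice made by \<open>frechet_derivative\<close> is the
  same even where there is none.\<close>

lemma frechet_derivative_cong_open:
  assumes "open S" "z \<in> S" "\<And>y. y \<in> S \<Longrightarrow> f y = f' y"
  shows "frechet_derivative f (at z) = frechet_derivative f' (at z)"
proof -
  have "(f has_derivative D) (at z) \<longleftrightarrow> (f' has_derivative D) (at z)" for D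
    using has_derivative_transform_within_open[OF _ assms(1,2), of f D UNIV f']
      has_derivative_transform_within_open[OF _ assms(1,2), of f' D UNIV f] assms(3) by auto
  then show ?thesis
    by (simp add: frechet_derivative_def)
qed

lemma partial_deriv_cong_open:
  assumes "open S" "z \<in> S" "\<And>y. y \<in> S \<Longrightarrow> f y = f' y"
  shows "partial_deriv i f z = partial_deriv i f' z"
  unfolding partial_deriv_def using frechet_derivative_cong_open[OF assms] by simp

lemma hessian_cong_open:
  assumes "open S" "z \<in> S" "\<And>y. y \<in> S \<Longrightarrow> f y = f' y"
  shows "hessian f z = hessian f' z"
proof -
  have "partial_deriv i (partial_deriv j f) z = partial_deriv i (partial_deriv j f') z" for i j
    using assms by (intro partial_deriv_cong_open[of S]) (auto intro: partial_deriv_cong_open)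
  then show ?thesis
    by (simp add: hessian_def)
qed

lemma Ck_on_cong_open:
  assumes S: "open S"
  shows "(\<And>y. y \<in> S \<Longrightarrow> f y = f' y) \<Longrightarrow> Ck_on k S f \<Longrightarrow> Ck_on k S f'"
proof (induction k arbitrary: f f')
  case 0
  have "continuous_on S f"
    using 0(2) by simp
  then have "continuous_on S f'"
    by (rule continuous_on_eq) (rule 0(1))
  then show ?case
    by simp
next
  case (Suc k)
  have f: "\<forall>z\<in>S. f differentiable (at z)" "\<And>i. Ck_on k S (partial_deriv i f)"
    using Suc.prems(2) by simp_all
  have "f' differentiable (at z)" if z: "z \<in> S" for z
  proof -
    obtain D where D: "(f has_derivative D) (at z)"
      using f(1) z unfolding differentiable_def by blast
    have "(f' has_derivative D) (at z)"
      by (rule has_derivative_transform_within_open[OF D S z]) (rule Suc.prems(1))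
    then show ?thesis
      by (rule differentiableI)
  qed
  moreover have "Ck_on k S (partial_deriv i f')" for i
    by (rule Suc.IH[OF _ f(2)[of i]], rule partial_deriv_cong_open[OF S]) (simp_all add: Suc.prems(1))
  ultimately show ?case
    by simp
qed

lemma Ck_on_subset: "Ck_on k S f \<Longrightarrow> T \<subseteq> S \<Longrightarrow> Ck_on k T f"
  by (induction k arbitrary: f) (auto intro: continuous_on_subset)

lemma smooth_on_cong_subset:
  assumes "open T" "T \<subseteq> S" "\<And>y. y \<in> T \<Longrightarrow> f y = f' y" "smooth_on S f"
  shows "smooth_on T f'"
  using assms Ck_on_cong_open Ck_on_subset unfolding smooth_on_def by metis

text \<open>The mean value theorem is applied twice along the segment, first to the function and
  then to its slope; positivity of the Hessian makes the remainder strictly positive.\<close>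

lemma strictly_convex_above_tangent:
  assumes F: "C2_data B F G H" and B: "convex B"
    and pos: "\<And>z \<xi>. z \<in> B \<Longrightarrow> \<xi> \<noteq> 0 \<Longrightarrow> 0 < (H z *v \<xi>) \<bullet> \<xi>"
    and xy: "x \<in> B" "y \<in> B" "x \<noteq> y"
  shows "F x + G x \<bullet> (y - x) < F y"
proof -
  let ?d = "y - x"
  have mem: "x + t *\<^sub>R ?d \<in> B" if "0 \<le> t" "t \<le> 1" for t
  proof -
    have "(1 - t) *\<^sub>R x + t *\<^sub>R y \<in> B"
      using B xy that by (intro convexD) auto
    then show ?thesis
      by (simp add: algebra_simps)
  qed
  obtain t where t: "0 < t" "t < 1" "F (x + 1 *\<^sub>R ?d) - F (x + 0 *\<^sub>R ?d) = (1 - 0) * (G (x + t *\<^sub>R ?d) \<bullet> ?d)"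
    using MVT2[of 0 1 "\<lambda>s. F (x + s *\<^sub>R ?d)" "\<lambda>s. G (x + s *\<^sub>R ?d) \<bullet> ?d"]
      C2_data_along_line(1)[OF F mem] by auto
  obtain s where s: "0 < s" "s < t" "G (x + t *\<^sub>R ?d) \<bullet> ?d - G (x + 0 *\<^sub>R ?d) \<bullet> ?d =
      (t - 0) * ((H (x + s *\<^sub>R ?d) *v ?d) \<bullet> ?d)"
    using MVT2[of 0 t "\<lambda>s. G (x + s *\<^sub>R ?d) \<bullet> ?d" "\<lambda>s. (H (x + s *\<^sub>R ?d) *v ?d) \<bullet> ?d"]
      C2_data_along_line(3)[OF F mem] t by auto
  have "0 < t * ((H (x + s *\<^sub>R ?d) *v ?d) \<bullet> ?d)"
    using s t xy by (intro mult_pos_pos pos mem) auto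
  then show ?thesis
    using s(3) t(3) by simp
qed

section \<open>Restriction of affine charts and potentials on coordinate balls\<close>

lemma coord_expr_eq:
  assumes "inj_on x U" "p \<in> U"
  shows "coord_expr (U, x) f (x p) = f p"
  using assms by (simp add: coord_expr_def)

lemma is_chart_iff:
  "is_chart (U, x) \<longleftrightarrow> open U \<and> open (x ` U) \<and> (\<exists>y. homeomorphism U (x ` U) x y)"
  by (simp add: is_chart_def)

lemma is_chartE:
  assumes "is_chart (U, x)"
  obtains y where "open U" "open (x ` U)" "homeomorphism U (x ` U) x y"
  using assms unfolding is_chart_iff by (elim conjE exE) (rule that)

lemma is_chart_inj: "is_chart (U, x) \<Longrightarrow> inj_on x U"
  by (auto simp: is_chart_def homeomorphism_def intro: inj_on_inverseI)

lemma affine_manifold_chart: "affine_manifold \<A> \<Longrightarrow> c \<in> \<A> \<Longrightarrow> is_chart c"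
  unfolding affine_manifold_def by blast

lemma affine_manifold_compatible:
  "affine_manifold \<A> \<Longrightarrow> c \<in> \<A> \<Longrightarrow> d \<in> \<A> \<Longrightarrow> affinely_compatible c d"
  unfolding affine_manifold_def by blast

lemma affine_manifold_maximal:
  "affine_manifold \<A> \<Longrightarrow> is_chart c \<Longrightarrow> (\<And>d. d \<in> \<A> \<Longrightarrow> affinely_compatible c d) \<Longrightarrow> c \<in> \<A>"
  unfolding affine_manifold_def by blast

text \<open>Maximality of the atlas reduces membership to compatibility, and the affine transition
  near a point survives shrinking the neighbourhood to \<open>V\<close>.\<close>

lemma restrict_chart:
  assumes M: "affine_manifold \<A>" and c: "(U, x) \<in> \<A>" and V: "open V" "V \<subseteq> U"
  shows "(V, x) \<in> \<A>"
proof -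
  have chart: "is_chart (U, x)"
    using affine_manifold_chart[OF M c] .
  then obtain y where U: "open U" "open (x ` U)" and y: "homeomorphism U (x ` U) x y"
    by (rule is_chartE)
  have "openin (top_of_set (x ` U)) (x ` V)"
    by (rule homeomorphism_imp_open_map[OF y]) (rule open_openin_trans[OF U(1) V])
  then have "open (x ` V)"
    by (rule openin_open_trans[OF _ U(2)])
  moreover have "homeomorphism V (x ` V) x y"
    by (rule homeomorphism_of_subsets[OF y V(2) subset_refl refl])
  ultimately have "is_chart (V, x)"
    unfolding is_chart_iff using V(1) by blast
  moreover have "affinely_compatible (V, x) d" if "d \<in> \<A>" for d
  proof -
    obtain T z where d: "d = (T, z)"
      by (cases d)
    have comp: "affinely_compatible (U, x) (T, z)"
      using affine_manifold_compatible[OF M c that] unfolding d .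
    then have loc: "\<forall>p\<in>U \<inter> T. \<exists>W A b. open W \<and> p \<in> W \<and> W \<subseteq> U \<inter> T \<and> invertible A \<and>
        (\<forall>q\<in>W. z q = A *v x q + b)"
      unfolding affinely_compatible_def prod.case .
    show ?thesis
      unfolding affinely_compatible_def d prod.case
    proof
      fix p assume p: "p \<in> V \<inter> T"
      then have "p \<in> U \<inter> T"
        using V(2) by auto
      from loc[rule_format, OF this] obtain W A b
        where W: "open W \<and> p \<in> W \<and> W \<subseteq> U \<inter> T \<and> invertible A \<and> (\<forall>q\<in>W. z q = A *v x q + b)"
        by (elim exE)
      then have "open (W \<inter> V) \<and> p \<in> W \<inter> V \<and> W \<inter> V \<subseteq> V \<inter> T \<and> invertible A \<and>
          (\<forall>q\<in>W \<inter> V. z q = A *v x q + b)"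
        using p V(1) by (auto simp: open_Int)
      then show "\<exists>W A b. open W \<and> p \<in> W \<and> W \<subseteq> V \<inter> T \<and> invertible A \<and> (\<forall>q\<in>W. z q = A *v x q + b)"
        by (intro exI)
    qed
  qed
  ultimately show ?thesis
    by (rule affine_manifold_maximal[OF M])
qed

text \<open>The coordinate map is the same, so the Jacobian in the transformation law is the
  identity matrix.\<close>

lemma metric_restrict_chart:
  assumes M: "affine_manifold \<A>" and g: "riemannian_metric \<A> g"
    and c: "(U, x) \<in> \<A>" "(V, x) \<in> \<A>" "V \<subseteq> U" and p: "p \<in> V"
  shows "g (V, x) p = g (U, x) p"
proof -
  have chart: "is_chart (V, x)"
    using affine_manifold_chart[OF M c(2)] .
  have "frechet_derivative (coord_expr (V, x) x) (at (x p)) = frechet_derivative (\<lambda>z. z) (at (x p))"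
    by (rule frechet_derivative_cong_open[of "x ` V"])
       (use chart p coord_expr_eq[OF is_chart_inj[OF chart]] in \<open>auto simp: is_chart_def\<close>)
  then have "coord_jacobian (U, x) (V, x) p = mat 1"
    by (simp add: coord_jacobian_def jacobian_def id_def[symmetric] matrix_id_mat_1)
  moreover have "g (V, x) p = transpose (coord_jacobian (U, x) (V, x) p) ** g (U, x) p **
      coord_jacobian (U, x) (V, x) p"
  proof -
    have "\<forall>c\<in>\<A>. \<forall>d\<in>\<A>. \<forall>p\<in>fst c \<inter> fst d.
        g d p = transpose (coord_jacobian c d p) ** g c p ** coord_jacobian c d p"
      using g unfolding riemannian_metric_def by blast
    from this[rule_format, OF c(1,2), of p] show ?thesis
      using c(3) p by auto
  qed
  ultimately show ?thesis
    by simp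
qed

lemma hessian_manifoldD:
  assumes "hessian_manifold \<A> g"
  shows "affine_manifold \<A>" "riemannian_metric \<A> g"
    and "c \<in> \<A> \<Longrightarrow> p \<in> fst c \<Longrightarrow> \<exists>W \<phi>. open W \<and> p \<in> W \<and> W \<subseteq> fst c \<and> is_potential g c W \<phi>"
  using assms by (simp_all add: hessian_manifold_def hessian_metric_def)

lemma affine_manifold_cover:
  assumes "affine_manifold \<A>"
  obtains U x where "(U, x) \<in> \<A>" "p \<in> U"
proof -
  have "(\<Union>(U, x)\<in>\<A>. U) = UNIV"
    using assms by (simp add: affine_manifold_def)
  then have "p \<in> (\<Union>(U, x)\<in>\<A>. U)"
    by simp
  then show thesis
    using that by auto
qed

text \<open>The definition of \<open>g_convex\<close> speaks only of charts with convex image and a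
  potential on the whole domain. One is obtained by shrinking a chart to a neighbourhood with a
  potential and then to the preimage of a coordinate ball.\<close>

lemma ball_chart:
  assumes HM: "hessian_manifold \<A> g"
  obtains U x \<phi> r where "(U, x) \<in> \<A>" "p \<in> U" "0 < r" "x ` U = ball (x p) r"
    "is_potential g (U, x) U \<phi>"
proof -
  note M = hessian_manifoldD(1)[OF HM] and g = hessian_manifoldD(2)[OF HM]
  obtain T x where c: "(T, x) \<in> \<A>" "p \<in> T"
    by (rule affine_manifold_cover[OF M])
  have pT: "p \<in> fst (T, x)"
    using c(2) by simp
  obtain W \<phi> where W': "open W \<and> p \<in> W \<and> W \<subseteq> fst (T, x) \<and> is_potential g (T, x) W \<phi>"
    using hessian_manifoldD(3)[OF HM c(1) pT] by (elim exE)
  then have W: "open W" "p \<in> W" "W \<subseteq> T" and pot: "is_potential g (T, x) W \<phi>"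
    by simp_all
  have cW: "(W, x) \<in> \<A>"
    by (rule restrict_chart[OF M c(1) W(1,3)])
  note chT = affine_manifold_chart[OF M c(1)] and chW = affine_manifold_chart[OF M cW]
  obtain y where y: "open (x ` W)" "homeomorphism W (x ` W) x y"
    using chW by (rule is_chartE)
  obtain r where r: "0 < r" "ball (x p) r \<subseteq> x ` W"
    using openE[OF y(1), of "x p"] W(2) by blast
  define U where "U = W \<inter> x -` ball (x p) r"
  have "continuous_on W x"
    using y(2) by (simp add: homeomorphism_def)
  then have oU: "open U"
    unfolding U_def using continuous_open_preimage[OF _ W(1) open_ball] by simp
  have UW: "U \<subseteq> W"
    by (simp add: U_def)
  then have UT: "U \<subseteq> T"
    using W(3) by (rule subset_trans)
  have cU: "(U, x) \<in> \<A>"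
    by (rule restrict_chart[OF M cW oU UW])
  have img: "x ` U = ball (x p) r"
    using r(2) by (auto simp: U_def)
  have chU: "is_chart (U, x)"
    using affine_manifold_chart[OF M cU] .
  have eq: "coord_expr (T, x) \<phi> z = coord_expr (U, x) \<phi> z" if z: "z \<in> x ` U" for z
  proof -
    obtain q where q: "q \<in> U" "z = x q"
      using z by blast
    then show ?thesis
      using coord_expr_eq[OF is_chart_inj[OF chT], of q \<phi>] coord_expr_eq[OF is_chart_inj[OF chU], of q \<phi>]
        UT by auto
  qed
  have openx: "open (x ` U)"
    using img by simp
  have smooth: "smooth_on (x ` W) (coord_expr (T, x) \<phi>)"
    and hess: "\<forall>p\<in>W. g (T, x) p = hessian (coord_expr (T, x) \<phi>) (x p)"
    using pot by (simp_all add: is_potential_def)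
  have "smooth_on (x ` U) (coord_expr (U, x) \<phi>)"
    by (rule smooth_on_cong_subset[OF openx image_mono[OF UW] eq smooth])
  moreover have "g (U, x) q = hessian (coord_expr (U, x) \<phi>) (x q)" if q: "q \<in> U" for q
  proof -
    have "g (U, x) q = g (T, x) q"
      by (rule metric_restrict_chart[OF M g c(1) cU UT q])
    also have "\<dots> = hessian (coord_expr (T, x) \<phi>) (x q)"
      using hess UW q by auto
    also have "\<dots> = hessian (coord_expr (U, x) \<phi>) (x q)"
      by (rule hessian_cong_open[OF openx imageI[OF q] eq])
    finally show ?thesis .
  qed
  ultimately have "is_potential g (U, x) U \<phi>"
    by (simp add: is_potential_def)
  moreover have "p \<in> U"
    using W(2) r(1) by (auto simp: U_def)
  ultimately show thesis
    by (intro that[OF cU _ r(1) img])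
qed

section \<open>Monge--Ampere measures\<close>

text \<open>Fubini for the region under the graph. Negative values of \<open>f\<close> are cut off
  by \<open>ennreal\<close> on the left and by \<open>t \<ge> 0\<close> on the right.\<close>

lemma nn_integral_layer_cake:
  fixes f :: "'a \<Rightarrow> real"
  assumes "sigma_finite_measure M" and f [measurable]: "f \<in> borel_measurable M"
  shows "(\<integral>\<^sup>+p. ennreal (f p) \<partial>M) = (\<integral>\<^sup>+t. emeasure M {p \<in> space M. t < f p} * indicator {0..} t \<partial>lborel)"
proof -
  interpret M: sigma_finite_measure M by fact
  interpret pair_sigma_finite M lborel ..
  have "(\<integral>\<^sup>+p. ennreal (f p) \<partial>M) = (\<integral>\<^sup>+p. \<integral>\<^sup>+t. indicator {t. 0 \<le> t \<and> t < f p} t \<partial>lborel \<partial>M)"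
  proof (intro nn_integral_cong)
    fix p
    have "{t. 0 \<le> t \<and> t < f p} = {0..<f p}"
      by auto
    then show "ennreal (f p) = (\<integral>\<^sup>+t. indicator {t. 0 \<le> t \<and> t < f p} t \<partial>lborel)"
      by (cases "0 \<le> f p") (simp_all add: ennreal_neg)
  qed
  also have "\<dots> = (\<integral>\<^sup>+t. \<integral>\<^sup>+p. indicator {t. 0 \<le> t \<and> t < f p} t \<partial>M \<partial>lborel)"
    by (rule Fubini'[symmetric]) (simp add: indicator_def case_prod_unfold)
  also have "\<dots> = (\<integral>\<^sup>+t. emeasure M {p \<in> space M. t < f p} * indicator {0..} t \<partial>lborel)"
  proof (intro nn_integral_cong)
    fix t :: real
    have "(\<integral>\<^sup>+p. indicator {t. 0 \<le> t \<and> t < f p} t \<partial>M) =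
        (\<integral>\<^sup>+p. indicator {p \<in> space M. t < f p} p * indicator {0..} t \<partial>M)"
      by (intro nn_integral_cong) (auto simp: indicator_def)
    also have "\<dots> = emeasure M {p \<in> space M. t < f p} * indicator {0..} t"
      by (subst nn_integral_multc) auto
    finally show "(\<integral>\<^sup>+p. indicator {t. 0 \<le> t \<and> t < f p} t \<partial>M) =
        emeasure M {p \<in> space M. t < f p} * indicator {0..} t" .
  qed
  finally show ?thesis .
qed

text \<open>Used to turn inequalities on superlevel sets into inequalities between integrals, which
  for continuous functions pass to weak limits.\<close>

lemma nn_integral_le_of_superlevel_sets:
  fixes f :: "'a \<Rightarrow> real"
  assumes "sigma_finite_measure M" "sigma_finite_measure N"
    and f: "f \<in> borel_measurable M" "f \<in> borel_measurable N"
    and le: "\<And>t. 0 \<le> t \<Longrightarrow> emeasure M {p \<in> space M. t < f p} \<le> C * emeasure N {p \<in> space N. t < f p}"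
  shows "(\<integral>\<^sup>+p. ennreal (f p) \<partial>M) \<le> C * (\<integral>\<^sup>+p. ennreal (f p) \<partial>N)"
proof -
  interpret N: sigma_finite_measure N by fact
  note f(2) [measurable]
  have [measurable]: "(\<lambda>t. emeasure N {p \<in> space N. t < f p}) \<in> borel_measurable lborel"
    by measurable
  have "(\<integral>\<^sup>+p. ennreal (f p) \<partial>M) =
      (\<integral>\<^sup>+t. emeasure M {p \<in> space M. t < f p} * indicator {0..} t \<partial>lborel)"
    by (rule nn_integral_layer_cake[OF assms(1) f(1)])
  also have "\<dots> \<le> (\<integral>\<^sup>+t. C * (emeasure N {p \<in> space N. t < f p} * indicator {0..} t) \<partial>lborel)"
    using le by (intro nn_integral_mono) (auto simp: indicator_def)
  also have "\<dots> = C * (\<integral>\<^sup>+t. emeasure N {p \<in> space N. t < f p} * indicator {0..} t \<partial>lborel)"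
    by (rule nn_integral_cmult) measurable
  also have "(\<integral>\<^sup>+t. emeasure N {p \<in> space N. t < f p} * indicator {0..} t \<partial>lborel) =
      (\<integral>\<^sup>+p. ennreal (f p) \<partial>N)"
    by (rule nn_integral_layer_cake[OF assms(2) f(2), symmetric])
  finally show ?thesis .
qed

section \<open>Monge-Ampere measures in a chart\<close>

lemma det_scaleR:
  fixes A :: "real^'n::finite^'n"
  shows "det (c *\<^sub>R A) = c ^ CARD('n) * det A"
  by (simp add: det_def prod.distrib sum_distrib_left mult_ac)

lemma transpose_add: "transpose (A + B) = transpose A + transpose B"
  for A B :: "real^'n::finite^'m::finite"
  by (simp add: transpose_def vec_eq_iff)

text \<open>Replaces the density \<rho> on a small set by its constant bounds.\<close>

lemma nn_integral_weight_bounds: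
  fixes r d :: "'a::euclidean_space \<Rightarrow> real"
  assumes meas: "set_borel_measurable borel S d"
    and r: "\<And>z. z \<in> S \<Longrightarrow> \<rho>1 \<le> r z" "\<And>z. z \<in> S \<Longrightarrow> r z \<le> \<rho>2" and "0 < \<rho>1"
  shows "ennreal \<rho>1 * (\<integral>\<^sup>+z\<in>S. ennreal (d z) \<partial>lborel) \<le> (\<integral>\<^sup>+z\<in>S. ennreal (r z * d z) \<partial>lborel)"
    and "(\<integral>\<^sup>+z\<in>S. ennreal (r z * d z) \<partial>lborel) \<le> ennreal \<rho>2 * (\<integral>\<^sup>+z\<in>S. ennreal (d z) \<partial>lborel)"
proof -
  have "(\<lambda>z. ennreal (indicator S z *\<^sub>R d z)) \<in> borel_measurable borel"
    using meas by (simp add: set_borel_measurable_def)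
  moreover have "(\<lambda>z. ennreal (indicator S z *\<^sub>R d z)) = (\<lambda>z. ennreal (d z) * indicator S z)"
    by (auto simp: fun_eq_iff indicator_def)
  ultimately have [measurable]: "(\<lambda>z. ennreal (d z) * indicator S z) \<in> borel_measurable borel"
    by simp
  \<comment> \<open>This also covers negative \<open>d z\<close>: the weight is positive, and both
    sides are then 0.\<close>
  have weight: "ennreal (r z * d z) = ennreal (r z) * ennreal (d z)" if "z \<in> S" for z
    using r(1)[OF that] \<open>0 < \<rho>1\<close> by (intro ennreal_mult') simp
  have "ennreal \<rho>1 * (\<integral>\<^sup>+z\<in>S. ennreal (d z) \<partial>lborel) =
      (\<integral>\<^sup>+z. ennreal \<rho>1 * (ennreal (d z) * indicator S z) \<partial>lborel)"
    by (rule nn_integral_cmult[symmetric]) simp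
  also have "\<dots> \<le> (\<integral>\<^sup>+z\<in>S. ennreal (r z * d z) \<partial>lborel)"
    using r weight by (intro nn_integral_mono) (auto simp: indicator_def intro!: mult_right_mono ennreal_leI)
  finally show "ennreal \<rho>1 * (\<integral>\<^sup>+z\<in>S. ennreal (d z) \<partial>lborel) \<le> (\<integral>\<^sup>+z\<in>S. ennreal (r z * d z) \<partial>lborel)" .
  have "(\<integral>\<^sup>+z\<in>S. ennreal (r z * d z) \<partial>lborel) \<le>
      (\<integral>\<^sup>+z. ennreal \<rho>2 * (ennreal (d z) * indicator S z) \<partial>lborel)"
    using r weight by (intro nn_integral_mono) (auto simp: indicator_def intro!: mult_right_mono ennreal_leI)
  also have "\<dots> = ennreal \<rho>2 * (\<integral>\<^sup>+z\<in>S. ennreal (d z) \<partial>lborel)"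
    by (rule nn_integral_cmult) simp
  finally show "(\<integral>\<^sup>+z\<in>S. ennreal (r z * d z) \<partial>lborel) \<le> ennreal \<rho>2 * (\<integral>\<^sup>+z\<in>S. ennreal (d z) \<partial>lborel)" .
qed

text \<open>The metric is the Hessian of \<phi>, so \<open>g + hessian w\<close> is the Hessian of
  \<phi> + w. It is written transposed to match \<open>smooth_on_C2_data\<close>.\<close>

lemma MA_measure_in_chart:
  assumes MA: "is_MA_measure_C2 \<A> g \<rho> w \<mu>" and c: "(U, x) \<in> \<A>" "is_chart (U, x)"
    and pot: "is_potential g (U, x) U \<phi>" and S: "S \<subseteq> U" "open S"
  shows "emeasure \<mu> S = (\<integral>\<^sup>+z\<in>x ` S. ennreal (coord_expr (U, x) (\<rho> (U, x)) z *
      det (transpose (hessian (coord_expr (U, x) \<phi>) z) + transpose (hessian (coord_expr (U, x) w) z))) \<partial>lborel)"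
proof -
  have "\<forall>c\<in>\<A>. \<forall>A\<in>sets borel. A \<subseteq> fst c \<longrightarrow> emeasure \<mu> A =
      (\<integral>\<^sup>+z\<in>snd c ` A. ennreal (coord_expr c (\<rho> c) z *
         det (coord_expr c (g c) z + hessian (coord_expr c w) z)) \<partial>lborel)"
    using MA by (simp add: is_MA_measure_C2_def)
  from this[rule_format, OF c(1), of S] S have "emeasure \<mu> S =
      (\<integral>\<^sup>+z\<in>x ` S. ennreal (coord_expr (U, x) (\<rho> (U, x)) z *
         det (coord_expr (U, x) (g (U, x)) z + hessian (coord_expr (U, x) w) z)) \<partial>lborel)"
    by simp
  also have "\<dots> = (\<integral>\<^sup>+z\<in>x ` S. ennreal (coord_expr (U, x) (\<rho> (U, x)) z *
      det (transpose (hessian (coord_expr (U, x) \<phi>) z) + transpose (hessian (coord_expr (U, x) w) z))) \<partial>lborel)"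
  proof (intro nn_integral_cong)
    fix z
    have "coord_expr (U, x) (g (U, x)) z = hessian (coord_expr (U, x) \<phi>) z" if z: "z \<in> x ` S"
    proof -
      obtain p where p: "p \<in> U" "z = x p"
        using z S(1) by auto
      then show ?thesis
        using pot coord_expr_eq[OF is_chart_inj[OF c(2)] p(1), of "g (U, x)"] by (simp add: is_potential_def)
    qed
    then show "ennreal (coord_expr (U, x) (\<rho> (U, x)) z *
          det (coord_expr (U, x) (g (U, x)) z + hessian (coord_expr (U, x) w) z)) * indicator (x ` S) z =
        ennreal (coord_expr (U, x) (\<rho> (U, x)) z *
          det (transpose (hessian (coord_expr (U, x) \<phi>) z) + transpose (hessian (coord_expr (U, x) w) z))) *
          indicator (x ` S) z"
      by (cases "z \<in> x ` S") (simp_all add: transpose_add[symmetric])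
  qed
  finally show ?thesis .
qed

lemma potential_plus_g_convex:
  assumes c: "(U, x) \<in> \<A>" and pot: "is_potential g (U, x) U \<phi>" and conv: "convex (x ` U)"
    and w: "smooth_function \<A> w" "g_convex \<A> g w"
  shows "C2_data (x ` U) (\<lambda>z. coord_expr (U, x) \<phi> z + coord_expr (U, x) w z)
      (\<lambda>z. grad (coord_expr (U, x) \<phi>) z + grad (coord_expr (U, x) w) z)
      (\<lambda>z. transpose (hessian (coord_expr (U, x) \<phi>) z) + transpose (hessian (coord_expr (U, x) w) z))"
    and "convex_on (x ` U) (\<lambda>z. coord_expr (U, x) \<phi> z + coord_expr (U, x) w z)"
proof -
  have "\<forall>(U, x)\<in>\<A>. smooth_on (x ` U) (coord_expr (U, x) w)"
    using w(1) by (simp add: smooth_function_def)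
  from bspec[OF this c] have "smooth_on (x ` U) (coord_expr (U, x) w)"
    by simp
  moreover have "smooth_on (x ` U) (coord_expr (U, x) \<phi>)"
    using pot by (simp add: is_potential_def)
  ultimately show "C2_data (x ` U) (\<lambda>z. coord_expr (U, x) \<phi> z + coord_expr (U, x) w z)
      (\<lambda>z. grad (coord_expr (U, x) \<phi>) z + grad (coord_expr (U, x) w) z)
      (\<lambda>z. transpose (hessian (coord_expr (U, x) \<phi>) z) + transpose (hessian (coord_expr (U, x) w) z))"
    by (intro C2_data_add smooth_on_C2_data)
  have "\<forall>(U, x)\<in>\<A>. \<forall>\<phi>. convex (x ` U) \<and> is_potential g (U, x) U \<phi> \<longrightarrow>
        convex_on (x ` U) (coord_expr (U, x) (\<lambda>p. \<phi> p + w p))"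
    using w(2) by (simp add: g_convex_def)
  from bspec[OF this c] have "convex_on (x ` U) (coord_expr (U, x) (\<lambda>p. \<phi> p + w p))"
    using pot conv by simp
  then show "convex_on (x ` U) (\<lambda>z. coord_expr (U, x) \<phi> z + coord_expr (U, x) w z)"
    by (simp add: coord_expr_def)
qed

lemma ennreal_mult_left_swap: "a \<le> c * b \<Longrightarrow> r * a \<le> c * (r * b)" for a b c r :: ennreal
  by (subst mult.left_commute) (rule mult_left_mono, simp_all)

text \<open>In coordinates \<open>h\<close> is the difference of \<phi> + w and (1 + \<epsilon>)
  (\<phi> + w') + a + b \<bullet> z, so the two determinant theorems apply to its superlevel sets.
  Scaling the Hessian contributes the factor \<open>(1 + \<epsilon>) ^ CARD('n)\<close>, and
  \<rho>1, \<rho>2 account for the passage between determinants and measures. The second part bounds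
  the measure of \<open>w'\<close> from below.\<close>

lemma MA_superlevel_comparison:
  fixes x :: "'a::{t2_space, second_countable_topology} \<Rightarrow> real^'n::finite"
  assumes c: "(U, x) \<in> \<A>" "is_chart (U, x)" and pot: "is_potential g (U, x) U \<phi>" and conv: "convex (x ` U)"
    and w: "smooth_function \<A> w" "g_convex \<A> g w" "is_MA_measure_C2 \<A> g \<rho> w M"
    and w': "smooth_function \<A> w'" "g_convex \<A> g w'" "is_MA_measure_C2 \<A> g \<rho> w' N"
    and B: "open B" "convex B" "B \<subseteq> x ` U"
    and h: "\<And>p. h p = w p - (1 + \<epsilon>) * w' p - \<epsilon> * \<phi> p - (a + b \<bullet> x p)"
    and K: "compact K" "K \<subseteq> B" "\<And>p. p \<in> U \<Longrightarrow> x p \<in> B \<Longrightarrow> t < h p \<Longrightarrow> x p \<in> K"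
    and \<rho>: "\<And>p. p \<in> U \<Longrightarrow> x p \<in> B \<Longrightarrow> \<rho>1 \<le> \<rho> (U, x) p \<and> \<rho> (U, x) p \<le> \<rho>2" "0 < \<rho>1" "0 \<le> \<epsilon>"
  shows "ennreal \<rho>1 * emeasure M {p \<in> U. x p \<in> B \<and> t < h p} \<le>
      ennreal (\<rho>2 * (1 + \<epsilon>) ^ CARD('n)) * emeasure N {p \<in> U. x p \<in> B \<and> t < h p}"
    and "p\<^sub>0 \<in> U \<Longrightarrow> x p\<^sub>0 \<in> B \<Longrightarrow> t + \<delta> \<le> h p\<^sub>0 \<Longrightarrow> 0 < R \<Longrightarrow> K \<subseteq> cball (x p\<^sub>0) R \<Longrightarrow> 0 < \<delta> \<Longrightarrow>
      ennreal \<rho>1 * emeasure lborel (ball (0::real^'n) (\<delta> / R)) \<le>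
      ennreal ((1 + \<epsilon>) ^ CARD('n)) * emeasure N {p \<in> U. x p \<in> B \<and> t < h p}"
proof -
  let ?c = "coord_expr (U, x)"
  let ?F = "\<lambda>w z. ?c \<phi> z + ?c w z" and ?G = "\<lambda>w z. grad (?c \<phi>) z + grad (?c w) z"
  let ?H = "\<lambda>w z. transpose (hessian (?c \<phi>) z) + transpose (hessian (?c w) z)"
  let ?W = "\<lambda>z. (1 + \<epsilon>) * ?F w' z + (a + b \<bullet> z)"
  \<comment> \<open>The summand 0 is the Hessian of the affine term, as delivered by
    \<open>C2_data_add\<close>.\<close>
  let ?HW = "\<lambda>z. (1 + \<epsilon>) *\<^sub>R ?H w' z + 0"
  let ?S = "{p \<in> U. x p \<in> B \<and> t < h p}" and ?Sz = "{z \<in> B. t < ?F w z - ?W z}"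
  have inj: "inj_on x U"
    using c(2) by (rule is_chart_inj)
  have oU: "open U"
    using c(2) by (simp add: is_chart_iff)
  have cont_x: "continuous_on U x"
    using c(2) by (rule is_chartE) (simp add: homeomorphism_def)
  have U: "C2_data B (?F w) (?G w) (?H w)" "convex_on B (?F w)"
    using potential_plus_g_convex[OF c(1) pot conv w(1,2)] C2_data_subset[OF _ B(3)]
      convex_on_subset[OF _ B(3) B(2)] by blast+
  have V: "C2_data B (?F w') (?G w') (?H w')" "convex_on B (?F w')"
    using potential_plus_g_convex[OF c(1) pot conv w'(1,2)] C2_data_subset[OF _ B(3)]
      convex_on_subset[OF _ B(3) B(2)] by blast+
  have W: "C2_data B ?W (\<lambda>z. (1 + \<epsilon>) *\<^sub>R ?G w' z + b) ?HW"
    by (rule C2_data_add[OF C2_data_cmult[OF V(1)] C2_data_affine])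
  have "convex_on B (\<lambda>z. b \<bullet> z + a)"
    using B(2) by (auto simp: convex_on_def inner_add_right algebra_simps)
      (metis (no_types, opaque_lifting) add.commute distrib_right mult_1 order_refl)
  then have Wc: "convex_on B ?W"
    using convex_on_add[OF convex_on_cmul[OF _ V(2), of "1 + \<epsilon>"], of "\<lambda>z. b \<bullet> z + a"] \<rho>(3)
    by (simp add: add.commute)
  have level: "?F w (x p) - ?W (x p) = h p" if "p \<in> U" for p
    using that by (simp add: coord_expr_eq[OF inj] h algebra_simps)
  have img: "x ` ?S = ?Sz"
  proof (rule set_eqI, rule iffI)
    fix z assume "z \<in> ?Sz"
    moreover then obtain p where "p \<in> U" "z = x p"
      using B(3) by blast
    ultimately show "z \<in> x ` ?S"
      using level by auto
  qed (use level in auto)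
  have KS: "?Sz \<subseteq> K"
    unfolding img[symmetric] using K(3) by blast
  have oSz: "open ?Sz"
    by (rule open_superlevel_set[OF B(1) U(1) W])
  have "?S = U \<inter> x -` ?Sz"
    unfolding img[symmetric] using inj by (auto simp: inj_on_def)
  then have oS: "open ?S"
    using continuous_open_preimage[OF cont_x oU oSz] by simp
  have ME: "emeasure M ?S = (\<integral>\<^sup>+z\<in>?Sz. ennreal (?c (\<rho> (U, x)) z * det (?H w z)) \<partial>lborel)"
    using MA_measure_in_chart[OF w(3) c pot _ oS] unfolding img by auto
  have NE: "emeasure N ?S = (\<integral>\<^sup>+z\<in>?Sz. ennreal (?c (\<rho> (U, x)) z * det (?H w' z)) \<partial>lborel)"
    using MA_measure_in_chart[OF w'(3) c pot _ oS] unfolding img by auto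
  have \<rho>z: "\<rho>1 \<le> ?c (\<rho> (U, x)) z" "?c (\<rho> (U, x)) z \<le> \<rho>2" if z: "z \<in> ?Sz" for z
  proof -
    obtain p where "p \<in> U" "z = x p" "x p \<in> B"
      using z B(3) by blast
    then show "\<rho>1 \<le> ?c (\<rho> (U, x)) z" "?c (\<rho> (U, x)) z \<le> \<rho>2"
      using \<rho>(1) coord_expr_eq[OF inj, of p "\<rho> (U, x)"] by auto
  qed
  have meas: "set_borel_measurable borel ?Sz (\<lambda>z. det (H z))" if "C2_data B F G H" for F G H
  proof -
    have "continuous_on ?Sz H"
      using that by (auto simp: C2_data_def intro: continuous_on_subset)
    then show ?thesis
      unfolding set_borel_measurable_def
      by (intro borel_measurable_continuous_on_indicator continuous_on_det borel_open oSz)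
  qed
  let ?n = "CARD('n)"
  have HW: "ennreal \<rho>1 * (\<integral>\<^sup>+z\<in>?Sz. ennreal (det (?HW z)) \<partial>lborel) \<le> ennreal ((1 + \<epsilon>) ^ ?n) * emeasure N ?S"
  proof -
    have "det (?HW z) = (1 + \<epsilon>) ^ ?n * det (?H w' z)" for z
      by (simp add: det_scaleR)
    then have "(\<integral>\<^sup>+z\<in>?Sz. ennreal (det (?HW z)) \<partial>lborel) =
        (\<integral>\<^sup>+z\<in>?Sz. ennreal ((1 + \<epsilon>) ^ ?n * det (?H w' z)) \<partial>lborel)"
      by simp
    also have "\<dots> \<le> ennreal ((1 + \<epsilon>) ^ ?n) * (\<integral>\<^sup>+z\<in>?Sz. ennreal (det (?H w' z)) \<partial>lborel)"
      by (rule nn_integral_weight_bounds(2)[OF meas[OF V(1)], of "(1 + \<epsilon>) ^ ?n"]) (use \<rho>(3) in auto)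
    finally have "ennreal \<rho>1 * (\<integral>\<^sup>+z\<in>?Sz. ennreal (det (?HW z)) \<partial>lborel) \<le>
        ennreal ((1 + \<epsilon>) ^ ?n) * (ennreal \<rho>1 * (\<integral>\<^sup>+z\<in>?Sz. ennreal (det (?H w' z)) \<partial>lborel))"
      by (rule ennreal_mult_left_swap)
    also have "\<dots> \<le> ennreal ((1 + \<epsilon>) ^ ?n) * emeasure N ?S"
      unfolding NE
      by (rule mult_left_mono[OF nn_integral_weight_bounds(1)[OF meas[OF V(1)] \<rho>z \<rho>(2)] zero_le])
    finally show ?thesis .
  qed
  \<comment> \<open>Without a point in the set, the bounds on \<rho> do not relate \<rho>1 and
    \<rho>2. A point yields \<rho>1 \<le> \<rho>2, hence the sign needed to factor the
    constant.\<close>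
  have "ennreal \<rho>1 * emeasure M ?S \<le> ennreal (\<rho>2 * (1 + \<epsilon>) ^ ?n) * emeasure N ?S" if "?S \<noteq> {}"
  proof -
    obtain p where "p \<in> ?S"
      using \<open>?S \<noteq> {}\<close> by blast
    then have "\<rho>1 \<le> \<rho>2"
      using \<rho>(1)[of p] by simp
    have "emeasure M ?S \<le> ennreal \<rho>2 * (\<integral>\<^sup>+z\<in>?Sz. ennreal (det (?H w z)) \<partial>lborel)"
      unfolding ME by (rule nn_integral_weight_bounds(2)[OF meas[OF U(1)] \<rho>z \<rho>(2)])
    also have "\<dots> \<le> ennreal \<rho>2 * (\<integral>\<^sup>+z\<in>?Sz. ennreal (det (?HW z)) \<partial>lborel)"
      by (rule mult_left_mono[OF hessian_det_comparison[OF B(1,2) U W Wc K(1,2) KS] zero_le])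
    finally have "ennreal \<rho>1 * emeasure M ?S \<le>
        ennreal \<rho>2 * (ennreal \<rho>1 * (\<integral>\<^sup>+z\<in>?Sz. ennreal (det (?HW z)) \<partial>lborel))"
      by (rule ennreal_mult_left_swap)
    also have "\<dots> \<le> ennreal \<rho>2 * (ennreal ((1 + \<epsilon>) ^ ?n) * emeasure N ?S)"
      by (rule mult_left_mono[OF HW zero_le])
    also have "\<dots> = ennreal (\<rho>2 * (1 + \<epsilon>) ^ ?n) * emeasure N ?S"
      using \<open>\<rho>1 \<le> \<rho>2\<close> \<rho>(2,3) by (simp add: ennreal_mult mult.assoc)
    finally show ?thesis .
  qed
  then show "ennreal \<rho>1 * emeasure M ?S \<le> ennreal (\<rho>2 * (1 + \<epsilon>) ^ ?n) * emeasure N ?S"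
  proof (cases "?S = {}")
    case True
    show ?thesis
      unfolding True by simp
  qed
  assume p0: "p\<^sub>0 \<in> U" "x p\<^sub>0 \<in> B" "t + \<delta> \<le> h p\<^sub>0" "0 < R" "K \<subseteq> cball (x p\<^sub>0) R" "0 < \<delta>"
  \<comment> \<open>By translation invariance only the radius counts. The bound therefore does not
    involve the gradient of \<open>w\<close>, and it will be uniform along the approximating
    sequences.\<close>
  have "emeasure lborel (ball (0::real^'n) (\<delta> / R)) = emeasure lborel (ball (?G w (x p\<^sub>0)) (\<delta> / R))"
    using p0 by (simp add: emeasure_ball)
  also have "\<dots> \<le> (\<integral>\<^sup>+z\<in>?Sz. ennreal (det (?HW z)) \<partial>lborel)"
    by (rule hessian_det_lower_bound[OF B(1,2) U W Wc K(1,2) KS p0(2) _ p0(4,5,6)])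
       (use level[OF p0(1)] p0(3) in simp)
  finally show "ennreal \<rho>1 * emeasure lborel (ball (0::real^'n) (\<delta> / R)) \<le>
      ennreal ((1 + \<epsilon>) ^ CARD('n)) * emeasure N ?S"
    using order_trans[OF mult_left_mono[OF _ zero_le] HW] by blast
qed

section \<open>Weak limits, weighted measures and continuous cutoffs\<close>

lemma integrable_continuous_compact:
  fixes f :: "'a::topological_space \<Rightarrow> real"
  assumes "compact (UNIV :: 'a set)" "finite_measure M" "sets M = sets borel" "continuous_on UNIV f"
  shows "integrable M f"
proof -
  interpret finite_measure M by fact
  have "bounded (range f)"
    using compact_continuous_image[OF assms(4,1)] by (rule compact_imp_bounded)
  then obtain C where "\<And>p. norm (f p) \<le> C"
    by (auto simp: bounded_iff)
  moreover have "f \<in> borel_measurable M"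
    using borel_measurable_continuous_onI[OF assms(4)] assms(3) by (simp cong: measurable_cong_sets)
  ultimately show ?thesis
    by (intro integrable_const_bound[of f C]) auto
qed

text \<open>Testing with the constant 1 bounds the total masses, so replacing \<open>F k\<close> by
  \<open>f\<close> costs at most the mass bound times their uniform distance. Continuity is asked of
  \<open>F k\<close> only eventually, since the cutoffs used later are continuous once the
  approximation is close enough.\<close>

lemma converges_weakly_uniform_limit:
  fixes f :: "'a::topological_space \<Rightarrow> real"
  assumes cpt: "compact (UNIV :: 'a set)" and M: "converges_weakly M \<mu>"
    and f: "continuous_on UNIV f" and F: "eventually (\<lambda>k. continuous_on UNIV (F k)) sequentially"
    and lim: "uniform_limit UNIV F f sequentially"
  shows "(\<lambda>k. integral\<^sup>L (M k) (F k)) \<longlonglongrightarrow> integral\<^sup>L \<mu> f"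
proof -
  have fin: "finite_measure (M k)" and sets: "sets (M k) = sets borel" for k
    using M by (auto simp: converges_weakly_def)
  have conv: "(\<lambda>k. integral\<^sup>L (M k) f') \<longlonglongrightarrow> integral\<^sup>L \<mu> f'" if "continuous_on UNIV f'" for f' :: "'a \<Rightarrow> real"
    using M that by (auto simp: converges_weakly_def)
  have "(\<lambda>k. integral\<^sup>L (M k) (\<lambda>_. 1)) \<longlonglongrightarrow> integral\<^sup>L \<mu> (\<lambda>_. 1 :: real)"
    by (rule conv) (rule continuous_on_const)
  then have "Bseq (\<lambda>k. measure (M k) (space (M k)))"
    by (intro convergent_imp_Bseq convergentI) simp
  then obtain C where C: "0 < C" "\<And>k. measure (M k) (space (M k)) \<le> C"
    unfolding Bseq_def by (auto simp: abs_le_iff)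
  have "(\<lambda>k. integral\<^sup>L (M k) (F k) - integral\<^sup>L (M k) f) \<longlonglongrightarrow> 0"
  proof (rule tendstoI)
    fix e :: real assume "0 < e"
    then have "0 < e / (2 * C)"
      using C by simp
    then have "eventually (\<lambda>k. \<forall>p\<in>UNIV. dist (F k p) (f p) < e / (2 * C)) sequentially"
      using lim by (simp add: uniform_limit_iff)
    then show "eventually (\<lambda>k. dist (integral\<^sup>L (M k) (F k) - integral\<^sup>L (M k) f) 0 < e) sequentially"
      using F
    proof eventually_elim
      case (elim k)
      interpret finite_measure "M k" by (rule fin)
      have iF: "integrable (M k) (F k)" and if': "integrable (M k) f"
        using integrable_continuous_compact[OF cpt fin sets] elim(2) f by auto
      have "\<bar>integral\<^sup>L (M k) (F k) - integral\<^sup>L (M k) f\<bar> = \<bar>integral\<^sup>L (M k) (\<lambda>p. F k p - f p)\<bar>"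
        using iF if' by simp
      also have "\<dots> \<le> integral\<^sup>L (M k) (\<lambda>p. \<bar>F k p - f p\<bar>)"
        by (rule integral_abs_bound)
      also have "\<dots> \<le> integral\<^sup>L (M k) (\<lambda>_. e / (2 * C))"
        by (intro integral_mono integrable_abs Bochner_Integration.integrable_diff iF if' integrable_const)
           (use elim(1) in \<open>auto simp: dist_real_def less_imp_le\<close>)
      also have "\<dots> = e / (2 * C) * measure (M k) (space (M k))"
        by simp
      also have "\<dots> \<le> e / (2 * C) * C"
        using C \<open>0 < e\<close> by (intro mult_left_mono) auto
      also have "\<dots> < e"
        using C \<open>0 < e\<close> by simp
      finally show ?case
        by simp
    qed
  qed
  from tendsto_add[OF this conv[OF f]] show ?thesis
    by simp
qed

text \<open>The test function is \<open>f\<close> times exp u. Against the weighted \<mu> it gives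
  the integral of \<open>f\<close>; against the weighted \<nu> it gives that of \<open>f\<close>
  times exp (u - v), which is at least exp d times \<open>f\<close>.\<close>

lemma density_domination:
  fixes f u v :: "'a::topological_space \<Rightarrow> real"
  assumes cpt: "compact (UNIV :: 'a set)"
    and \<mu>: "finite_measure \<mu>" "sets \<mu> = sets borel" and \<nu>: "finite_measure \<nu>" "sets \<nu> = sets borel"
    and cont: "continuous_on UNIV u" "continuous_on UNIV v" "continuous_on UNIV f"
    and le: "\<And>A. A \<in> sets borel \<Longrightarrow>
      emeasure (density \<nu> (\<lambda>p. ennreal (exp (- v p)))) A \<le> emeasure (density \<mu> (\<lambda>p. ennreal (exp (- u p)))) A"
    and f: "\<And>p. 0 \<le> f p" "\<And>p. 0 < f p \<Longrightarrow> d \<le> u p - v p"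
  shows "exp d * integral\<^sup>L \<nu> f \<le> integral\<^sup>L \<mu> f"
proof -
  have bor: "k \<in> borel_measurable \<mu>" "k \<in> borel_measurable \<nu>" if "continuous_on UNIV k" for k :: "'a \<Rightarrow> real"
    using borel_measurable_continuous_onI[OF that] \<mu>(2) \<nu>(2) by (simp_all cong: measurable_cong_sets)
  have fin: "finite_measure (density N (\<lambda>p. ennreal (exp (- k p))))"
    if "finite_measure N" "sets N = sets borel" "continuous_on UNIV k" for N and k :: "'a \<Rightarrow> real"
  proof (rule finite_measureI)
    have "integrable N (\<lambda>p. exp (- k p))"
      by (rule integrable_continuous_compact[OF cpt that(1,2)]) (intro continuous_intros that(3))
    then have "(\<integral>\<^sup>+p. ennreal (exp (- k p)) \<partial>N) < \<infinity>"
      by (simp add: nn_integral_eq_integral)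
    moreover have "(\<lambda>p. ennreal (exp (- k p))) \<in> borel_measurable N"
      using borel_measurable_integrable[OF \<open>integrable N (\<lambda>p. exp (- k p))\<close>] by simp
    ultimately show "emeasure (density N (\<lambda>p. ennreal (exp (- k p))))
        (space (density N (\<lambda>p. ennreal (exp (- k p))))) \<noteq> \<infinity>"
      by (simp add: emeasure_density cong: nn_integral_cong_simp)
  qed
  let ?D\<mu> = "density \<mu> (\<lambda>p. ennreal (exp (- u p)))" and ?D\<nu> = "density \<nu> (\<lambda>p. ennreal (exp (- v p)))"
  let ?f = "\<lambda>p. f p * exp (u p)"
  have cf: "continuous_on UNIV ?f"
    by (intro continuous_intros cont)
  have space: "space \<mu> = UNIV" "space \<nu> = UNIV"
    using sets_eq_imp_space_eq[OF \<mu>(2)] sets_eq_imp_space_eq[OF \<nu>(2)] by simp_all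
  have "(\<integral>\<^sup>+p. ennreal (?f p) \<partial>?D\<nu>) \<le> 1 * (\<integral>\<^sup>+p. ennreal (?f p) \<partial>?D\<mu>)"
  proof (rule nn_integral_le_of_superlevel_sets)
    show "sigma_finite_measure ?D\<nu>" "sigma_finite_measure ?D\<mu>"
      using fin \<mu> \<nu> cont finite_measure.axioms by blast+
    show "?f \<in> borel_measurable ?D\<nu>" "?f \<in> borel_measurable ?D\<mu>"
      using bor[OF cf] by simp_all
    have "{p. t < ?f p} \<in> sets borel" for t
    proof -
      have "open {p. t < ?f p}"
        by (intro open_Collect_less cf continuous_on_const)
      then show ?thesis
        by (rule borel_open)
    qed
    then show "emeasure ?D\<nu> {p \<in> space ?D\<nu>. t < ?f p} \<le> 1 * emeasure ?D\<mu> {p \<in> space ?D\<mu>. t < ?f p}" for t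
      using le by (simp add: space)
  qed
  moreover have "(\<integral>\<^sup>+p. ennreal (?f p) \<partial>?D\<mu>) = (\<integral>\<^sup>+p. ennreal (f p) \<partial>\<mu>)"
    using bor[OF cont(1)] bor[OF cf] f(1)
    by (subst nn_integral_density) (auto intro!: nn_integral_cong simp: ennreal_mult[symmetric] exp_minus)
  moreover have "(\<integral>\<^sup>+p. ennreal (exp d * f p) \<partial>\<nu>) \<le> (\<integral>\<^sup>+p. ennreal (?f p) \<partial>?D\<nu>)"
  proof -
    have "exp d * f p \<le> exp (- v p) * (f p * exp (u p))" for p
    proof (cases "f p = 0")
      case False
      then have "exp d \<le> exp (u p - v p)"
        using f(1)[of p] f(2)[of p] by simp
      then have "exp d * f p \<le> exp (u p - v p) * f p"
        using f(1) by (rule mult_right_mono)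
      then show ?thesis
        by (simp add: exp_diff exp_minus field_simps)
    qed simp
    then have "(\<integral>\<^sup>+p. ennreal (exp d * f p) \<partial>\<nu>) \<le> (\<integral>\<^sup>+p. ennreal (exp (- v p)) * ennreal (?f p) \<partial>\<nu>)"
      using f(1) by (intro nn_integral_mono) (simp add: ennreal_mult[symmetric] ennreal_leI)
    also have "\<dots> = (\<integral>\<^sup>+p. ennreal (?f p) \<partial>?D\<nu>)"
      using bor[OF cont(2)] bor[OF cf] by (subst nn_integral_density) auto
    finally show ?thesis .
  qed
  ultimately have "(\<integral>\<^sup>+p. ennreal (exp d * f p) \<partial>\<nu>) \<le> (\<integral>\<^sup>+p. ennreal (f p) \<partial>\<mu>)"
    by simp
  moreover have "integrable \<mu> f" "integrable \<nu> (\<lambda>p. exp d * f p)"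
    by (auto intro!: integrable_continuous_compact[OF cpt] \<mu> \<nu> continuous_intros cont)
  ultimately have "ennreal (integral\<^sup>L \<nu> (\<lambda>p. exp d * f p)) \<le> ennreal (integral\<^sup>L \<mu> f)"
    using f(1) by (simp add: nn_integral_eq_integral)
  then have "integral\<^sup>L \<nu> (\<lambda>p. exp d * f p) \<le> integral\<^sup>L \<mu> f"
    using f(1) by (subst (asm) ennreal_le_iff) (auto intro: integral_nonneg)
  then show ?thesis
    by simp
qed

text \<open>Two open sets cover the manifold: the part of the chart over \<open>B\<close>, where the
  function is \<open>max 0 (f p)\<close>, and the complement of the part over \<open>K\<close>,
  where it vanishes. The latter is open because compact subsets of a Hausdorff space are
  closed.\<close>

lemma continuous_on_cutoff:
  fixes x :: "'a::t2_space \<Rightarrow> real^'n::finite"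
  assumes c: "is_chart (U, x)" and B: "open B" "B \<subseteq> x ` U" and K: "compact K" "K \<subseteq> B"
    and f: "continuous_on U f" "\<And>p. p \<in> U \<Longrightarrow> x p \<in> B \<Longrightarrow> 0 < f p \<Longrightarrow> x p \<in> K"
  shows "continuous_on UNIV (\<lambda>p. if p \<in> U \<and> x p \<in> B then max 0 (f p) else (0::real))"
proof -
  let ?F = "\<lambda>p. if p \<in> U \<and> x p \<in> B then max 0 (f p) else 0"
  obtain y where U: "open U" and y: "homeomorphism U (x ` U) x y"
    using c by (rule is_chartE)
  have oV: "open (U \<inter> x -` B)"
    using y by (intro continuous_open_preimage U B) (simp add: homeomorphism_def)
  have "continuous_on (x ` U) y"
    using y by (simp add: homeomorphism_def)
  then have "continuous_on K y"
    by (rule continuous_on_subset) (rule subset_trans[OF K(2) B(2)])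
  then have "compact (y ` K)"
    using K(1) by (rule compact_continuous_image)
  then have oK: "open (- (y ` K))"
    by (intro open_Compl compact_imp_closed)
  have yK: "p \<in> y ` K" if p: "p \<in> U" "x p \<in> B" "0 < f p" for p
    using f(2)[OF p] homeomorphism_apply1[OF y p(1)] by force
  have "continuous_on (- (y ` K)) ?F"
  proof (rule continuous_on_eq)
    show "continuous_on (- (y ` K)) (\<lambda>_. 0 :: real)"
      by (rule continuous_on_const)
    show "0 = ?F p" if "p \<in> - (y ` K)" for p
      using that yK[of p] by (auto simp: max_def)
  qed
  moreover have "continuous_on (U \<inter> x -` B) ?F"
  proof (rule continuous_on_eq)
    show "continuous_on (U \<inter> x -` B) (\<lambda>p. max 0 (f p))"
      by (intro continuous_intros continuous_on_subset[OF f(1)]) auto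
  qed auto
  ultimately have "continuous_on (U \<inter> x -` B \<union> - (y ` K)) ?F"
    by (rule continuous_on_open_Un[OF oV oK, rotated])
  moreover have "U \<inter> x -` B \<union> - (y ` K) = UNIV"
  proof -
    have "y z \<in> U \<and> x (y z) \<in> B" if z: "z \<in> K" for z
    proof -
      obtain p where "p \<in> U" "z = x p"
        using z K(2) B(2) by blast
      then show ?thesis
        using homeomorphism_apply1[OF y] z K(2) by auto
    qed
    then show ?thesis
      by blast
  qed
  ultimately show ?thesis
    by simp
qed

lemma obtain_small_parameter:
  assumes "0 < m"
  obtains \<epsilon> :: real where "0 < \<epsilon>" "(1 + \<epsilon>) ^ k < exp m" "\<epsilon> * C < m"
proof -
  have "((\<lambda>\<epsilon>. (1 + \<epsilon>) ^ k) \<longlongrightarrow> (1 + 0) ^ k) (at_right (0::real))"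
    by (intro tendsto_intros)
  then have "eventually (\<lambda>\<epsilon>. (1 + \<epsilon>) ^ k < exp m) (at_right (0::real))"
    by (rule order_tendstoD) (use assms in simp)
  moreover have "((\<lambda>\<epsilon>. \<epsilon> * C) \<longlongrightarrow> 0 * C) (at_right (0::real))"
    by (intro tendsto_intros)
  then have "eventually (\<lambda>\<epsilon>. \<epsilon> * C < m) (at_right (0::real))"
    by (rule order_tendstoD) (use assms in simp)
  ultimately have "eventually (\<lambda>\<epsilon>. 0 < \<epsilon> \<and> (1 + \<epsilon>) ^ k < exp m \<and> \<epsilon> * C < m) (at_right (0::real))"
    using eventually_at_right_less[of "0::real"] by eventually_elim simp
  then have "\<exists>\<epsilon>. 0 < \<epsilon> \<and> (1 + \<epsilon>) ^ k < exp m \<and> \<epsilon> * C < m"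
    by (rule eventually_happens'[rotated]) simp
  then show thesis
    by (elim exE conjE) (rule that)
qed

lemma is_MA_measureE:
  assumes "is_MA_measure \<A> g \<rho> u \<mu>"
  obtains w M where "\<forall>k. smooth_function \<A> (w k) \<and> g_convex \<A> g (w k) \<and> is_MA_measure_C2 \<A> g \<rho> (w k) (M k)"
    "uniform_limit UNIV w u sequentially" "converges_weakly M \<mu>"
  using assms unfolding is_MA_measure_def by (elim exE conjE) (rule that)

theorem theorem2p14:
  fixes \<A> :: "('a::{t2_space, second_countable_topology}, 'n::finite) chart set"
    and g :: "('a, 'n) chart \<Rightarrow> 'a \<Rightarrow> real^'n^'n"
    and \<rho> :: "('a, 'n) chart \<Rightarrow> 'a \<Rightarrow> real"
    and u v :: "'a \<Rightarrow> real"
    and \<mu> \<nu> :: "'a measure"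
  assumes "compact (UNIV :: 'a set)"
    and "hessian_manifold \<A> g"
    and "positive_neg1_density \<A> \<rho>"
    and "g_convex \<A> g u"
    and "g_convex \<A> g v"
    and "is_MA_measure \<A> g \<rho> u \<mu>"
    and "is_MA_measure \<A> g \<rho> v \<nu>"
    and "\<And>A. A \<in> sets borel \<Longrightarrow>
      emeasure (density \<mu> (\<lambda>p. ennreal (exp (- u p)))) A \<ge>
      emeasure (density \<nu> (\<lambda>p. ennreal (exp (- v p)))) A"
  shows "\<forall>p. u p \<le> v p"
proof (rule ccontr)
  note cpt = assms(1)
  let ?n = "CARD('n)"
  assume "\<not> (\<forall>p. u p \<le> v p)"
  then obtain q where q: "v q < u q"
    by (auto simp: not_le)
  \<comment> \<open>At \<open>q\<close> and at \<open>p0\<close> the term \<epsilon> v costs less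
    than \<open>m\<close> each, so a quarter of the gap leaves u - v > m at
    \<open>p0\<close>.\<close>
  define m where "m = (u q - v q) / 4"
  have "0 < m"
    using q by (simp add: m_def)
  have cu: "continuous_on UNIV u" and cv: "continuous_on UNIV v"
    using assms(4,5) by (simp_all add: g_convex_def)

  obtain w1 M where M: "\<forall>k. smooth_function \<A> (w1 k) \<and> g_convex \<A> g (w1 k) \<and>
      is_MA_measure_C2 \<A> g \<rho> (w1 k) (M k)"
    and lim1: "uniform_limit UNIV w1 u sequentially" and weak1: "converges_weakly M \<mu>"
    by (rule is_MA_measureE[OF assms(6)])
  note w1 = M[rule_format, THEN conjunct1] M[rule_format, THEN conjunct2, THEN conjunct1]
    M[rule_format, THEN conjunct2, THEN conjunct2]
  obtain w2 N where N: "\<forall>k. smooth_function \<A> (w2 k) \<and> g_convex \<A> g (w2 k) \<and>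
      is_MA_measure_C2 \<A> g \<rho> (w2 k) (N k)"
    and lim2: "uniform_limit UNIV w2 v sequentially" and weak2: "converges_weakly N \<nu>"
    by (rule is_MA_measureE[OF assms(7)])
  note w2 = N[rule_format, THEN conjunct1] N[rule_format, THEN conjunct2, THEN conjunct1]
    N[rule_format, THEN conjunct2, THEN conjunct2]
  have fin: "finite_measure (M k)" "finite_measure (N k)" "finite_measure \<mu>" "finite_measure \<nu>"
    and sets: "sets (M k) = sets borel" "sets (N k) = sets borel" "sets \<mu> = sets borel" "sets \<nu> = sets borel" for k
    using weak1 weak2 by (simp_all add: converges_weakly_def)

  \<comment> \<open>The parameter and the maximum point\<close>
  have "bounded (range v)"
    using compact_continuous_image[OF cv cpt] by (rule compact_imp_bounded)
  then obtain C where C: "\<And>p. \<bar>v p\<bar> \<le> C"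
    by (auto simp: bounded_real)
  \<comment> \<open>The exponent counts one factor per dimension from the determinant and one from
    the oscillation of \<rho>.\<close>
  obtain \<epsilon> where \<epsilon>: "0 < \<epsilon>" "(1 + \<epsilon>) ^ (?n + 1) < exp m" "\<epsilon> * C < m"
    by (rule obtain_small_parameter[OF \<open>0 < m\<close>])
  have "continuous_on UNIV (\<lambda>p. u p - (1 + \<epsilon>) * v p)"
    by (intro continuous_intros cu cv)
  then obtain p0 where p0: "\<And>p. u p - (1 + \<epsilon>) * v p \<le> u p0 - (1 + \<epsilon>) * v p0"
    using continuous_attains_sup[OF cpt UNIV_not_empty] by blast
  have gap: "m < u p0 - v p0"
  proof -
    have "\<epsilon> * v q \<le> \<epsilon> * C" "\<epsilon> * (- v p0) \<le> \<epsilon> * C"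
      by (rule mult_left_mono; use C[of q] C[of p0] \<epsilon>(1) in linarith)+
    moreover have "u q - v q - \<epsilon> * v q \<le> u p0 - v p0 - \<epsilon> * v p0"
      using p0[of q] by (simp add: algebra_simps)
    ultimately show ?thesis
      using \<epsilon>(3) m_def \<open>0 < m\<close> by simp
  qed

  \<comment> \<open>A coordinate ball around the maximum point\<close>
  note Mf = hessian_manifoldD(1)[OF assms(2)]
  obtain U x \<phi> r where c: "(U, x) \<in> \<A>" and p0U: "p0 \<in> U" and r: "0 < r" "x ` U = ball (x p0) r"
    and pot: "is_potential g (U, x) U \<phi>"
    by (rule ball_chart[OF assms(2)])
  have chart: "is_chart (U, x)"
    by (rule affine_manifold_chart[OF Mf c])
  have inj: "inj_on x U"
    using chart by (rule is_chart_inj)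
  have conv: "convex (x ` U)"
    using r(2) by simp
  obtain y where oU: "open U" and y: "homeomorphism U (x ` U) x y"
    using chart by (rule is_chartE)
  have cx: "continuous_on U x"
    using y by (simp add: homeomorphism_def)
  let ?c = "coord_expr (U, x)" and ?z0 = "x p0" and ?\<rho> = "\<rho> (U, x)"
  have c\<phi>: "C2_data (x ` U) (?c \<phi>) (grad (?c \<phi>)) (\<lambda>z. transpose (hessian (?c \<phi>) z))"
    using pot by (intro smooth_on_C2_data) (simp add: is_potential_def)

  have c\<rho>: "continuous_on U ?\<rho>" and \<rho>pos: "\<forall>p\<in>U. 0 < ?\<rho> p"
  proof -
    have "\<forall>c\<in>\<A>. continuous_on (fst c) (\<rho> c) \<and> (\<forall>p\<in>fst c. \<rho> c p > 0)"
      using assms(3) unfolding positive_neg1_density_def by (rule conjunct1)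
    from bspec[OF this c] show "continuous_on U ?\<rho>" "\<forall>p\<in>U. 0 < ?\<rho> p"
      by simp_all
  qed
  \<comment> \<open>Any number with \<rho>1 < \<rho> < (1 + \<epsilon>) \<rho>1 at \<open>p0\<close>
    would do; by continuity the bounds persist nearby.\<close>
  define \<rho>1 where "\<rho>1 = 2 * ?\<rho> p0 / (2 + \<epsilon>)"
  have \<rho>1: "0 < \<rho>1" "\<rho>1 < ?\<rho> p0" "?\<rho> p0 < (1 + \<epsilon>) * \<rho>1"
    using \<rho>pos p0U \<epsilon>(1) by (auto simp: \<rho>1_def field_simps)
  define V where "V = U \<inter> (\<lambda>p. u p - v p) -` {m<..} \<inter> (U \<inter> ?\<rho> -` {\<rho>1<..<(1 + \<epsilon>) * \<rho>1})"
  have V: "V \<subseteq> U" "p0 \<in> V" "\<And>p. p \<in> V \<Longrightarrow> m < u p - v p"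
    "\<And>p. p \<in> V \<Longrightarrow> \<rho>1 \<le> ?\<rho> p \<and> ?\<rho> p \<le> (1 + \<epsilon>) * \<rho>1"
    using p0U gap \<rho>1 by (auto simp: V_def)
  have "open V"
    unfolding V_def
    by (intro open_Int continuous_open_preimage c\<rho> oU open_greaterThan open_greaterThanLessThan
        continuous_on_diff continuous_on_subset[OF cu] continuous_on_subset[OF cv] subset_UNIV)
  then have "is_chart (V, x)"
    by (intro affine_manifold_chart[OF Mf] restrict_chart[OF Mf c] V(1))
  then have "open (x ` V)"
    by (simp add: is_chart_iff)
  then obtain d where d: "0 < d" "ball ?z0 d \<subseteq> x ` V"
    using openE[of "x ` V" ?z0] V(2) by blast
  define R where "R = d / 2"
  have R: "0 < R" "cball ?z0 R \<subseteq> x ` V"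
    using d by (auto simp: R_def)
  let ?B = "ball ?z0 R" and ?K = "cball ?z0 (R / 2)"
  have RU: "cball ?z0 R \<subseteq> x ` U"
    by (rule subset_trans[OF R(2) image_mono[OF V(1)]])
  have BU: "?B \<subseteq> x ` U"
    by (rule subset_trans[OF ball_subset_cball RU])
  have inV: "p \<in> V" if p: "p \<in> U" "x p \<in> cball ?z0 R" for p
  proof -
    obtain p' where "p' \<in> V" "x p' = x p"
      using p(2) R(2) by (metis imageE subsetD)
    then show ?thesis
      using inj p(1) V(1) by (metis inj_onD subsetD)
  qed

  define \<psi> where "\<psi> z = ?c \<phi> z - ?c \<phi> ?z0 - grad (?c \<phi>) ?z0 \<bullet> (z - ?z0)" for z
  \<comment> \<open>\<psi> is the height of the potential above its tangent at \<open>p0\<close>;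
    positive definiteness of the metric makes it positive elsewhere.\<close>
  have \<psi>pos: "0 < \<psi> z" if z: "z \<in> x ` U" "z \<noteq> ?z0" for z
  proof -
    have "0 < (transpose (hessian (?c \<phi>) z) *v \<xi>) \<bullet> \<xi>" if z: "z \<in> x ` U" and \<xi>: "\<xi> \<noteq> 0" for z \<xi>
    proof -
      obtain p where p: "p \<in> U" "z = x p"
        using z by blast
      have "\<forall>c\<in>\<A>. \<forall>p\<in>fst c. transpose (g c p) = g c p \<and> (\<forall>\<xi>. \<xi> \<noteq> 0 \<longrightarrow> \<xi> \<bullet> (g c p *v \<xi>) > 0)"
        using hessian_manifoldD(2)[OF assms(2)] unfolding riemannian_metric_def by (rule conjunct1)
      from bspec[OF bspec[OF this c], of p] p(1) \<xi> have "0 < \<xi> \<bullet> (g (U, x) p *v \<xi>)"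
        by simp
      also have "g (U, x) p = hessian (?c \<phi>) z"
        using pot p by (simp add: is_potential_def)
      finally show ?thesis
        by (simp add: dot_lmul_matrix)
    qed
    then have "?c \<phi> ?z0 + grad (?c \<phi>) ?z0 \<bullet> (z - ?z0) < ?c \<phi> z"
      by (intro strictly_convex_above_tangent[OF c\<phi> conv]) (use z p0U in auto)
    then show ?thesis
      by (simp add: \<psi>_def)
  qed
  have c\<phi>U: "continuous_on (x ` U) (?c \<phi>)"
  proof -
    have "?c \<phi> differentiable (at z)" if "z \<in> x ` U" for z
      using c\<phi> that unfolding C2_data_def differentiable_def by blast
    then show ?thesis
      by (meson continuous_at_imp_continuous_on differentiable_imp_continuous_within)
  qed
  have c\<phi>p: "continuous_on U \<phi>"
  proof (rule continuous_on_eq)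
    show "continuous_on U (\<lambda>p. ?c \<phi> (x p))"
      by (rule continuous_on_compose2[OF c\<phi>U cx]) simp
  qed (simp add: coord_expr_eq[OF inj])
  \<comment> \<open>\<kappa> is the minimum of \<psi> over the compact shell between the radii R / 2
    and R; for an empty shell any positive number, here 1, qualifies.\<close>
  obtain \<kappa> where \<kappa>: "0 < \<kappa>" "\<And>z. z \<in> cball ?z0 R \<Longrightarrow> R / 2 \<le> dist ?z0 z \<Longrightarrow> \<kappa> \<le> \<psi> z"
  proof (cases "cball ?z0 R - ball ?z0 (R / 2) = {}")
    case True
    then show thesis
      by (intro that[of 1]) (auto simp: not_less[symmetric])
  next
    case False
    have "compact (cball ?z0 R - ball ?z0 (R / 2))"
      by (intro compact_diff compact_cball open_ball)
    moreover have "continuous_on (cball ?z0 R - ball ?z0 (R / 2)) \<psi>"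
      unfolding \<psi>_def by (intro continuous_intros continuous_on_subset[OF c\<phi>U]) (use RU in auto)
    ultimately obtain z1 where z1: "z1 \<in> cball ?z0 R - ball ?z0 (R / 2)"
      and min: "\<And>z. z \<in> cball ?z0 R - ball ?z0 (R / 2) \<Longrightarrow> \<psi> z1 \<le> \<psi> z"
      using continuous_attains_inf[OF _ False] by blast
    have "0 < \<psi> z1"
      by (rule \<psi>pos) (use z1 RU R(1) in auto)
    then show thesis
      by (rule that) (use min in auto)
  qed

  \<comment> \<open>The tilted difference and its perturbations\<close>
  define b where "b = - \<epsilon> *\<^sub>R grad (?c \<phi>) ?z0"
  \<comment> \<open>\<open>b\<close> removes the linear part of -\<epsilon> \<phi> at
    \<open>p0\<close>, leaving -\<epsilon> \<psi> up to a constant, and \<open>a\<close> makes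
    \<open>h u v p0\<close> equal to 0.\<close>
  define a where "a = u p0 - (1 + \<epsilon>) * v p0 - \<epsilon> * \<phi> p0 - b \<bullet> ?z0"
  \<comment> \<open>On the shell \<open>h u v\<close> is at most -2 s. A perturbation below s / 2
    keeps it under -s there, while it stays above -s / 2 at \<open>p0\<close>.\<close>
  define s where "s = \<epsilon> * \<kappa> / 2"
  have "0 < s"
    using \<epsilon>(1) \<kappa>(1) by (simp add: s_def)
  \<comment> \<open>In the chart this is \<open>(\<phi> + w) - ((1 + \<epsilon>) (\<phi> + w') + a + b \<bullet> z)\<close>.\<close>
  define h where "h w w' p = w p - (1 + \<epsilon>) * w' p - \<epsilon> * \<phi> p - (a + b \<bullet> x p)" for w w' :: "'a \<Rightarrow> real" and p
  have h_uv: "h u v p \<le> - \<epsilon> * \<psi> (x p)" if "p \<in> U" for p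
  proof -
    have "h u v p = (u p - (1 + \<epsilon>) * v p) - (u p0 - (1 + \<epsilon>) * v p0) - \<epsilon> * \<psi> (x p)"
      using that p0U by (simp add: h_def a_def b_def \<psi>_def coord_expr_eq[OF inj] algebra_simps inner_simps)
    then show ?thesis
      using p0[of p] by simp
  qed
  have h_p0: "h u v p0 = 0"
    by (simp add: h_def a_def)
  define close where "close w w' \<longleftrightarrow> (\<forall>p. \<bar>h w w' p - h u v p\<bar> < s / 2)" for w w'
  have h_diff: "\<bar>h w w' p - h u v p\<bar> \<le> \<bar>w p - u p\<bar> + (1 + \<epsilon>) * \<bar>w' p - v p\<bar>" for w w' p
  proof -
    have "h w w' p - h u v p = (w p - u p) - (1 + \<epsilon>) * (w' p - v p)"
      by (simp add: h_def algebra_simps)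
    also have "\<bar>\<dots>\<bar> \<le> \<bar>w p - u p\<bar> + \<bar>(1 + \<epsilon>) * (w' p - v p)\<bar>"
      by (rule abs_triangle_ineq4)
    also have "\<bar>(1 + \<epsilon>) * (w' p - v p)\<bar> = (1 + \<epsilon>) * \<bar>w' p - v p\<bar>"
      using \<epsilon>(1) by (simp add: abs_mult)
    finally show ?thesis .
  qed
  have ev_h: "eventually (\<lambda>k. \<forall>p. \<bar>h (w1 k) (w2 k) p - h u v p\<bar> < e) sequentially" if e: "0 < e" for e
  proof -
    define e' where "e' = e / (2 + \<epsilon>)"
    have e': "0 < e'" "(2 + \<epsilon>) * e' = e"
      using e \<epsilon>(1) by (auto simp: e'_def)
    have "eventually (\<lambda>k. \<forall>p\<in>UNIV. dist (w1 k p) (u p) < e') sequentially"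
      "eventually (\<lambda>k. \<forall>p\<in>UNIV. dist (w2 k p) (v p) < e') sequentially"
      using lim1 lim2 e'(1) by (auto simp: uniform_limit_iff)
    then show ?thesis
    proof eventually_elim
      case (elim k)
      show ?case
      proof
        fix p
        have "\<bar>w1 k p - u p\<bar> < e'" "\<bar>w2 k p - v p\<bar> < e'"
          using elim by (auto simp: dist_real_def)
        then have "\<bar>w1 k p - u p\<bar> + (1 + \<epsilon>) * \<bar>w2 k p - v p\<bar> < e' + (1 + \<epsilon>) * (e')"
          using \<epsilon>(1) by (intro add_strict_mono mult_strict_left_mono) auto
        also have "\<dots> = e"
          using e'(2) by (simp add: algebra_simps)
        finally show "\<bar>h (w1 k) (w2 k) p - h u v p\<bar> < e"
          using h_diff[of "w1 k" "w2 k" p] by simp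
      qed
    qed
  qed
  have close_uv: "close u v"
    using \<open>0 < s\<close> by (simp add: close_def)
  have ev_close: "eventually (\<lambda>k. close (w1 k) (w2 k)) sequentially"
    unfolding close_def by (rule ev_h) (use \<open>0 < s\<close> in simp)

  \<comment> \<open>This is the positive part of \<open>h + s\<close>, cut off to the coordinate
    ball. For close \<open>w\<close> and \<open>w'\<close> it is positive only over
    \<open>?K\<close>, so the extension by 0 is continuous.\<close>
  define T where "T w w' p = (if p \<in> U \<and> x p \<in> ?B then max 0 (h w w' p + s) else 0)" for w w' p
  have T_nonneg: "0 \<le> T w w' p" for w w' p
    by (simp add: T_def)
  have inK: "x p \<in> ?K" if "close w w'" "p \<in> U" "x p \<in> ?B" "- s < h w w' p" for w w' p
  proof (rule ccontr)
    assume "x p \<notin> ?K"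
    then have "\<kappa> \<le> \<psi> (x p)"
      using that(3) by (intro \<kappa>(2)) auto
    then have "\<epsilon> * \<kappa> \<le> \<epsilon> * \<psi> (x p)"
      using \<epsilon>(1) by simp
    then have "h u v p \<le> - 2 * s"
      using h_uv[OF that(2)] by (simp add: s_def)
    moreover have "\<bar>h w w' p - h u v p\<bar> < s / 2"
      using that(1) by (simp add: close_def)
    ultimately show False
      using that(4) \<open>0 < s\<close> by linarith
  qed
  have T_cont: "continuous_on UNIV (T w w')"
    if "continuous_on UNIV w" "continuous_on UNIV w'" "close w w'" for w w'
    unfolding T_def[abs_def]
  proof (rule continuous_on_cutoff[OF chart open_ball BU compact_cball])
    show "?K \<subseteq> ?B"
      using R(1) by auto
    show "continuous_on U (\<lambda>p. h w w' p + s)"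
      unfolding h_def
      by (intro continuous_intros continuous_on_subset[OF that(1)] continuous_on_subset[OF that(2)] c\<phi>p cx subset_UNIV)
    show "x p \<in> ?K" if "p \<in> U" "x p \<in> ?B" "0 < h w w' p + s" for p
      using inK[OF \<open>close w w'\<close> that(1,2)] that(3) by simp
  qed
  have cw: "continuous_on UNIV (w1 k)" "continuous_on UNIV (w2 k)" for k
    using w1(2)[of k] w2(2)[of k] by (simp_all add: g_convex_def)
  let ?T = "\<lambda>k. T (w1 k) (w2 k)"
  have T_lim: "uniform_limit UNIV ?T (T u v) sequentially"
  proof (rule uniform_limitI)
    fix e :: real assume "0 < e"
    have le: "\<bar>T w w' p - T u v p\<bar> \<le> \<bar>h w w' p - h u v p\<bar>" for w w' p
      by (auto simp: T_def max_def)
    show "eventually (\<lambda>k. \<forall>p\<in>UNIV. dist (?T k p) (T u v p) < e) sequentially"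
      using ev_h[OF \<open>0 < e\<close>]
    proof eventually_elim
      case (elim k)
      then show ?case
        unfolding dist_real_def using le le_less_trans by blast
    qed
  qed
  have ev_cont: "eventually (\<lambda>k. continuous_on UNIV (?T k)) sequentially"
    using ev_close by eventually_elim (rule T_cont[OF cw])
  have T_level: "{p. t < T w w' p} = {p \<in> U. x p \<in> ?B \<and> t - s < h w w' p}" if "0 \<le> t" for t w w'
    using that by (auto simp: T_def)
  have \<rho>B: "\<rho>1 \<le> ?\<rho> p \<and> ?\<rho> p \<le> (1 + \<epsilon>) * \<rho>1" if "p \<in> U" "x p \<in> ?B" for p
    using V(4) inV that by auto
  have inKt: "x p \<in> ?K" if "close w w'" "0 \<le> t" "p \<in> U" "x p \<in> ?B" "t - s < h w w' p" for w w' p t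
    using inK that by auto
  have KB: "?K \<subseteq> ?B"
    using R(1) by auto
  have space: "space (M k) = UNIV" "space (N k) = UNIV" for k
    using sets_eq_imp_space_eq[OF sets(1)] sets_eq_imp_space_eq[OF sets(2)] by simp_all

  \<comment> \<open>Comparison of the integrals along the sequences\<close>
  have compare: "integral\<^sup>L (M k) (?T k) \<le> (1 + \<epsilon>) ^ (?n + 1) * integral\<^sup>L (N k) (?T k)"
    if cl: "close (w1 k) (w2 k)" for k
  proof -
    have iM: "integrable (M k) (?T k)" and iN: "integrable (N k) (?T k)"
      by (rule integrable_continuous_compact[OF cpt fin(1) sets(1) T_cont[OF cw cl]],
          rule integrable_continuous_compact[OF cpt fin(2) sets(2) T_cont[OF cw cl]])
    have "emeasure (M k) {p. t < ?T k p} \<le> ennreal ((1 + \<epsilon>) ^ (?n + 1)) * emeasure (N k) {p. t < ?T k p}"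
      if t: "0 \<le> t" for t
    proof -
      let ?S = "{p \<in> U. x p \<in> ?B \<and> t - s < h (w1 k) (w2 k) p}"
      have "ennreal \<rho>1 * emeasure (M k) ?S \<le> ennreal ((1 + \<epsilon>) * \<rho>1 * (1 + \<epsilon>) ^ ?n) * emeasure (N k) ?S"
        by (rule MA_superlevel_comparison(1)[where \<rho> = \<rho>, OF c chart pot conv w1 w2 open_ball convex_ball BU
              _ compact_cball KB inKt[OF cl t] \<rho>B \<rho>1(1) less_imp_le[OF \<epsilon>(1)]])
           (simp_all add: h_def)
      also have "(1 + \<epsilon>) * \<rho>1 * (1 + \<epsilon>) ^ ?n = \<rho>1 * (1 + \<epsilon>) ^ (?n + 1)"
        by simp
      also have "ennreal (\<rho>1 * (1 + \<epsilon>) ^ (?n + 1)) = ennreal \<rho>1 * ennreal ((1 + \<epsilon>) ^ (?n + 1))"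
        using \<rho>1(1) \<epsilon>(1) by (intro ennreal_mult) auto
      also have "\<dots> * emeasure (N k) ?S = ennreal \<rho>1 * (ennreal ((1 + \<epsilon>) ^ (?n + 1)) * emeasure (N k) ?S)"
        by (rule mult.assoc)
      \<comment> \<open>The positive finite factor \<rho>1 cancels; of \<rho> only the oscillation
        factor 1 + \<epsilon> remains, giving the exponent n + 1.\<close>
      finally have "emeasure (M k) ?S \<le> ennreal ((1 + \<epsilon>) ^ (?n + 1)) * emeasure (N k) ?S"
        using \<rho>1(1) by (simp add: ennreal_mult_le_mult_iff)
      then show ?thesis
        by (simp only: T_level[OF t])
    qed
    then have "(\<integral>\<^sup>+p. ennreal (?T k p) \<partial>M k) \<le> ennreal ((1 + \<epsilon>) ^ (?n + 1)) * (\<integral>\<^sup>+p. ennreal (?T k p) \<partial>N k)"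
      by (intro nn_integral_le_of_superlevel_sets finite_measure.axioms(1)[OF fin(1)]
          finite_measure.axioms(1)[OF fin(2)] borel_measurable_integrable[OF iM]
          borel_measurable_integrable[OF iN]) (simp add: space)
    then have "ennreal (integral\<^sup>L (M k) (?T k)) \<le> ennreal ((1 + \<epsilon>) ^ (?n + 1) * integral\<^sup>L (N k) (?T k))"
      using iM iN T_nonneg \<epsilon>(1)
      by (simp add: nn_integral_eq_integral ennreal_mult Bochner_Integration.integral_nonneg)
    then show ?thesis
      using T_nonneg \<epsilon>(1)
      by (subst (asm) ennreal_le_iff) (auto intro!: mult_nonneg_nonneg Bochner_Integration.integral_nonneg)
  qed

  \<comment> \<open>At the level s / 4 of \<open>T\<close>, that is s / 4 - s of \<open>h\<close>,
    there is still an excess of s / 4 at \<open>p0\<close>. Slopes then fill a ball of radius s / 4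
    / R, which bounds the measure of the superlevel set from below, and \<open>T\<close> exceeds s /
    4 on that set.\<close>
  define c0 where "c0 = s / 4 * (\<rho>1 * measure lborel (ball (0::real^'n) (s / 4 / R)) / (1 + \<epsilon>) ^ ?n)"
  have "0 < c0"
    using \<open>0 < s\<close> \<rho>1(1) \<epsilon>(1) R(1) unfolding c0_def
    by (intro mult_pos_pos divide_pos_pos content_ball_pos zero_less_power) auto
  have lower: "c0 \<le> integral\<^sup>L (N k) (?T k)" if cl: "close (w1 k) (w2 k)" for k
  proof -
    interpret Nk: finite_measure "N k"
      by (rule fin)
    let ?S = "{p \<in> U. x p \<in> ?B \<and> s / 4 - s < h (w1 k) (w2 k) p}"
    have S: "?S = {p. s / 4 < ?T k p}"
      using T_level[of "s / 4"] \<open>0 < s\<close> by simp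
    have s4: "0 \<le> s / 4"
      using \<open>0 < s\<close> by simp
    have iN: "integrable (N k) (?T k)"
      by (rule integrable_continuous_compact[OF cpt fin(2) sets(2) T_cont[OF cw cl]])
    have "\<bar>h (w1 k) (w2 k) p0 - h u v p0\<bar> < s / 2"
      using cl by (simp add: close_def)
    then have hp0: "(s / 4 - s) + s / 4 \<le> h (w1 k) (w2 k) p0"
      using h_p0 by simp
    have "ennreal \<rho>1 * emeasure lborel (ball (0::real^'n) (s / 4 / R)) \<le>
        ennreal ((1 + \<epsilon>) ^ ?n) * emeasure (N k) ?S"
      by (rule MA_superlevel_comparison(2)[where \<rho> = \<rho>,
            OF c chart pot conv w1 w2 open_ball convex_ball BU
            _ compact_cball KB inKt[OF cl s4] \<rho>B \<rho>1(1) less_imp_le[OF \<epsilon>(1)] p0U])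
         (use hp0 \<open>0 < s\<close> R(1) in \<open>simp_all add: h_def subset_cball\<close>)
    also have "emeasure lborel (ball (0::real^'n) (s / 4 / R)) = ennreal (measure lborel (ball (0::real^'n) (s / 4 / R)))"
      by (rule emeasure_eq_ennreal_measure) (use emeasure_lborel_ball_finite in \<open>simp add: less_top\<close>)
    also have "emeasure (N k) ?S = ennreal (measure (N k) ?S)"
      by (rule Nk.emeasure_eq_measure)
    finally have "ennreal (\<rho>1 * measure lborel (ball (0::real^'n) (s / 4 / R))) \<le>
        ennreal ((1 + \<epsilon>) ^ ?n * measure (N k) ?S)"
      using \<rho>1(1) \<epsilon>(1) by (simp add: ennreal_mult)
    then have "\<rho>1 * measure lborel (ball (0::real^'n) (s / 4 / R)) \<le> (1 + \<epsilon>) ^ ?n * measure (N k) ?S"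
      using \<epsilon>(1) by (subst (asm) ennreal_le_iff) auto
    then have "\<rho>1 * measure lborel (ball (0::real^'n) (s / 4 / R)) / (1 + \<epsilon>) ^ ?n \<le> measure (N k) ?S"
      using \<epsilon>(1) by (simp add: divide_le_eq mult.commute)
    then have "c0 \<le> s / 4 * measure (N k) ?S"
      unfolding c0_def using \<open>0 < s\<close> by (intro mult_left_mono) auto
    also have "\<dots> \<le> integral\<^sup>L (N k) (?T k)"
    proof -
      have mS: "?S \<in> sets (N k)"
        unfolding S sets(2) by (intro borel_open open_Collect_less continuous_on_const T_cont[OF cw cl])
      have "s / 4 * measure (N k) ?S = integral\<^sup>L (N k) (\<lambda>p. s / 4 * indicator ?S p)"
        using mS by (simp add: space)
      also have "\<dots> \<le> integral\<^sup>L (N k) (?T k)"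
      proof (rule integral_mono)
        show "integrable (N k) (\<lambda>p. s / 4 * indicator ?S p)"
          by (intro integrable_mult_right integrable_real_indicator mS) (simp add: Nk.emeasure_eq_measure)
        show "s / 4 * indicator ?S p \<le> ?T k p" for p
          unfolding S using T_nonneg[of "w1 k" "w2 k" p] by (auto simp: indicator_def)
      qed (rule iN)
      finally show ?thesis .
    qed
    finally show ?thesis .
  qed

  \<comment> \<open>Passage to the weak limits and contradiction\<close>
  have Tuv: "continuous_on UNIV (T u v)"
    by (rule T_cont[OF cu cv close_uv])
  have limM: "(\<lambda>k. integral\<^sup>L (M k) (?T k)) \<longlonglongrightarrow> integral\<^sup>L \<mu> (T u v)"
    by (rule converges_weakly_uniform_limit[OF cpt weak1 Tuv ev_cont T_lim])
  have limN: "(\<lambda>k. integral\<^sup>L (N k) (?T k)) \<longlonglongrightarrow> integral\<^sup>L \<nu> (T u v)"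
    by (rule converges_weakly_uniform_limit[OF cpt weak2 Tuv ev_cont T_lim])
  have "integral\<^sup>L \<mu> (T u v) \<le> (1 + \<epsilon>) ^ (?n + 1) * integral\<^sup>L \<nu> (T u v)"
    by (rule tendsto_le[OF sequentially_bot tendsto_mult_left[OF limN] limM])
       (use ev_close compare in \<open>auto elim: eventually_mono\<close>)
  \<comment> \<open>The bound \<open>c0\<close> does not depend on \<open>k\<close>, so the limit
    integral stays positive and can be cancelled against exp m > (1 + \<epsilon>)^(n + 1).\<close>
  moreover have "c0 \<le> integral\<^sup>L \<nu> (T u v)"
    by (rule tendsto_lowerbound[OF limN]) (use ev_close lower in \<open>auto elim: eventually_mono\<close>)
  moreover have "exp m * integral\<^sup>L \<nu> (T u v) \<le> integral\<^sup>L \<mu> (T u v)"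
  proof (rule density_domination[OF cpt fin(3) sets(3) fin(4) sets(4) cu cv Tuv assms(8) T_nonneg])
    show "m \<le> u p - v p" if "0 < T u v p" for p
    proof -
      have "p \<in> U" "x p \<in> ?B"
        using that by (auto simp: T_def split: if_splits)
      then show ?thesis
        using V(3)[of p] inV[of p] by simp
    qed
  qed
  ultimately have "exp m * integral\<^sup>L \<nu> (T u v) \<le> (1 + \<epsilon>) ^ (?n + 1) * integral\<^sup>L \<nu> (T u v)"
      and "0 < integral\<^sup>L \<nu> (T u v)"
    using \<open>0 < c0\<close> by linarith+
  then show False
    using \<epsilon>(2) by simp
qed

end
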